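(* Let $m,\lambda:\mathbb{R}_+\times\mathbb{R}^d\to\mathbb{R}_+$ and $a^-:\mathbb{R}^d\times\mathbb{R}^d\to\mathbb{R}_+$ be continuous and bounded, let $a^+:\mathbb{R}^d\times\mathbb{R}^d\to\mathbb{R}_+$ be continuous with $\int_{\mathbb{R}^d}a^+(x,y)\,dy=1$ for all $x\in\mathbb{R}^d$, and suppose that for any compact $\Lambda\subset\mathbb{R}^d$ there exists $0\le a^*\in L^1(\mathbb{R}^d)$ such that $a^+(x,y)\le a^*(y)$ for all $x\in\Lambda$, $y\in\mathbb{R}^d$. Consider on $\Gamma_0$ the transition function of the BDLP model, $$Q(t,\eta,A)=\sum_{x\in\eta}\Big(m(t,x)+\sum_{y\in\eta\backslash x}a^-(x,y)\Big)\mathbf{1}_A(\eta\backslash x)+\sum_{x\in\eta}\lambda(t,x)\int_{\mathbb{R}^d}a^+(x,y)\mathbf{1}_A(\eta\cup y)\,dy,$$ for $t\ge0$, $\eta\in\Gamma_0$, $A\in\mathcal{B}(\Gamma_0)$, and let $q(t,\eta)=Q(t,\eta,\Gamma_0)$. Then the following conditions hold for $V(\eta)=|\eta|+|\eta|^2$: (A) For any $\varepsilon>0$, $T>0$ and any compact $B\subset\Gamma_0$ there exists a compact $A\subset\Gamma_0$ such that $\int_0^TQ(r,\eta,A^c)\,dr<\varepsilon$ for all $\eta\in B$. (B) There exists a continuous function $c:\mathbb{R}_+\to\mathbb{R}_+$ such that $\int_{\Gamma_0}V(\omega)\,Q(t,\eta,d\omega)\le c(t)V(\eta)+q(t,\eta)V(\eta)$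 for all $t\ge0$, $\eta\in\Gamma_0$. (C) For any continuous $F:\Gamma_0\to\mathbb{R}$ with $\sup_{\eta\in\Gamma_0}\frac{|F(\eta)|}{1+V(\eta)}<\infty$ the map $(t,\eta)\mapsto\int_{\Gamma_0}F(\omega)\,Q(t,\eta,d\omega)$ is continuous. (D) For any $T>0$ there exists $a(T)>0$ such that $q(t,\eta)\le a(T)V(\eta)$ for all $\eta\in\Gamma_0$ and $t\in[0,T]$.
   Context: $\Gamma_0=\{\eta\subset\mathbb{R}^d : |\eta|<\infty\}=\bigsqcup_{n\ge0}\Gamma_0^{(n)}$ is the space of finite subsets of $\mathbb{R}^d$, where $|\eta|$ is the cardinality and $\Gamma_0^{(n)}=\{|\eta|=n\}$. $\Gamma_0^{(n)}$ carries the quotient topology under $(x_1,\dots,x_n)\mapsto\{x_1,\dots,x_n\}$ from the set of $n$-tuples of pairwise distinct points, and $\Gamma_0$ the disjoint union topology; it is a locally compact Polish space with Borel $\sigma$-algebra $\mathcal{B}(\Gamma_0)$. We write $\eta\backslash x$, $\eta\cup x$ for $\eta\backslash\{x\}$, $\eta\cup\{x\}$. The corresponding (pre-)generator of the BDLP model is $$(L(t)F)(\eta)=\sum_{x\in\eta}\Big(m(t,x)+\sum_{y\in\eta\backslash x}a^-(x,y)\Big)(F(\eta\backslash x)-F(\eta))+\sum_{x\in\eta}\lambda(t,x)\int_{\mathbb{R}^d}a^+(x,y)(F(\eta\cup y)-F(\eta))\,dy,$$ i.e. $L(t)F(\eta)=\int_{\Gamma_0}(F(\omega)-F(\eta))\,Q(t,\eta,d\omega)$.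 *)

theory Defs
  imports "HOL-Analysis.Analysis" "HOL-Library.FSet"
begin

section \<open>The space of finite configurations\<close>

text \<open>
  \<open>\<Gamma>\<^sub>0\<close> is the type \<open>'a fset\<close> with \<open>'a\<close> of class \<open>euclidean_space\<close>. An \<open>n\<close>-tuple is a function on
  \<open>{..<n}\<close> (undefined elsewhere), so that the space of \<open>n\<close>-tuples is a product topology with
  \<open>n\<close> varying over the natural numbers.
\<close>

definition distinct_tuples :: "nat \<Rightarrow> (nat \<Rightarrow> 'a::topological_space) topology" where
  "distinct_tuples n =
    subtopology (product_topology (\<lambda>_. euclidean) {..<n}) {x. inj_on x {..<n}}"

definition tuple_fset :: "nat \<Rightarrow> (nat \<Rightarrow> 'a) \<Rightarrow> 'a fset" where
  "tuple_fset n x = x |`| fset_of_list [0..<n]"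

lemma fset_tuple_fset [simp]: "fset (tuple_fset n x) = x ` {..<n}"
  by (auto simp: tuple_fset_def fset_of_list.rep_eq)

text \<open>
  The disjoint union of the quotient topologies on the sets \<open>{\<eta>. fcard \<eta> = n}\<close>; see the lemmas
  \<open>quotient_map_tuple_fset\<close> and \<open>open_fset_disjoint_union\<close> below.
\<close>

instantiation fset :: (topological_space) topological_space
begin

definition open_fset :: "'a fset set \<Rightarrow> bool" where
  "open_fset U \<longleftrightarrow>
    (\<forall>n. openin (distinct_tuples n) {x \<in> topspace (distinct_tuples n). tuple_fset n x \<in> U})"

instance
proof
  show "open (UNIV :: 'a fset set)"
    by (simp add: open_fset_def)
next
  fix S T :: "'a fset set"
  assume "open S" "open T"
  moreover have "{x \<in> topspace (distinct_tuples n). tuple_fset n x \<in> S \<inter> T} =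
      {x \<in> topspace (distinct_tuples n). tuple_fset n x \<in> S} \<inter>
      {x \<in> topspace (distinct_tuples n). tuple_fset n x \<in> T}" for n
    by auto
  ultimately show "open (S \<inter> T)"
    by (simp add: open_fset_def openin_Int)
next
  fix K :: "'a fset set set"
  assume K: "\<forall>S\<in>K. open S"
  have "{x \<in> topspace (distinct_tuples n). tuple_fset n x \<in> \<Union>K} =
      (\<Union>S\<in>K. {x \<in> topspace (distinct_tuples n). tuple_fset n x \<in> S})" for n
    by auto
  then show "open (\<Union>K)"
    using K by (auto simp: open_fset_def)
qed

end

lemma fcard_tuple_fset:
  assumes "x \<in> topspace (distinct_tuples n)"
  shows "fcard (tuple_fset n x) = n"
  using assms by (simp add: fcard.rep_eq distinct_tuples_def card_image)

lemma nth_in_distinct_tuples: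
  assumes "distinct xs"
  shows "restrict ((!) xs) {..<length xs} \<in> topspace (distinct_tuples (length xs))"
  using assms by (auto simp: distinct_tuples_def inj_on_def nth_eq_iff_index_eq)

lemma tuple_fset_nth: "tuple_fset (length xs) (restrict ((!) xs) {..<length xs}) = fset_of_list xs"
proof -
  have "(!) xs ` {..<length xs} = set xs"
    by (auto simp: set_conv_nth)
  then show ?thesis
    by (simp add: fset_inject[symmetric] fset_of_list.rep_eq)
qed

lemma tuple_fset_surj:
  assumes "fcard \<eta> = n"
  obtains x where "x \<in> topspace (distinct_tuples n)" "tuple_fset n x = \<eta>"
proof -
  obtain xs where xs: "set xs = fset \<eta>" "distinct xs"
    using finite_distinct_list[of "fset \<eta>"] by auto
  then have "length xs = n"
    using assms distinct_card[of xs] by (simp add: fcard.rep_eq)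
  moreover have "fset_of_list xs = \<eta>"
    using xs by (simp add: fset_inject[symmetric] fset_of_list.rep_eq)
  ultimately show thesis
    using that nth_in_distinct_tuples[OF xs(2)] tuple_fset_nth[of xs] by metis
qed

lemma open_fset_fcard_eq: "open {\<eta> :: 'a::topological_space fset. fcard \<eta> = n}"
  unfolding open_fset_def
proof
  fix k
  have "{x \<in> topspace (distinct_tuples k). tuple_fset k x \<in> {\<eta> :: 'a fset. fcard \<eta> = n}} =
      (if k = n then topspace (distinct_tuples k) else {})"
    by (auto simp: fcard_tuple_fset)
  then show "openin (distinct_tuples k)
      {x \<in> topspace (distinct_tuples k). tuple_fset k x \<in> {\<eta> :: 'a fset. fcard \<eta> = n}}"
    by simp
qed

lemma open_fset_disjoint_union:
  "open U \<longleftrightarrow> (\<forall>n. openin (top_of_set {\<eta>. fcard \<eta> = n}) (U \<inter> {\<eta>. fcard \<eta> = n}))"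
    (is "_ \<longleftrightarrow> ?R")
proof
  assume "open U"
  then show ?R by (auto simp: openin_open)
next
  assume ?R
  then have "open (U \<inter> {\<eta>. fcard \<eta> = n})" for n
    using openin_open_eq[OF open_fset_fcard_eq] by blast
  then have "open (\<Union>n. U \<inter> {\<eta>. fcard \<eta> = n})" by blast
  moreover have "(\<Union>n. U \<inter> {\<eta>. fcard \<eta> = n}) = U" by auto
  ultimately show "open U" by simp
qed

lemma quotient_map_tuple_fset:
  "quotient_map (distinct_tuples n) (top_of_set {\<eta> :: 'a::topological_space fset. fcard \<eta> = n})
     (tuple_fset n)"
  unfolding quotient_map_def
proof (intro conjI allI impI)
  show "tuple_fset n ` topspace (distinct_tuples n) =
      topspace (top_of_set {\<eta> :: 'a fset. fcard \<eta> = n})"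
    by (auto simp: fcard_tuple_fset) (metis (full_types) image_eqI tuple_fset_surj)
next
  fix U :: "'a fset set"
  assume "U \<subseteq> topspace (top_of_set {\<eta>. fcard \<eta> = n})"
  then have U: "U \<subseteq> {\<eta>. fcard \<eta> = n}" by simp
  have empty: "{x \<in> topspace (distinct_tuples k). tuple_fset k x \<in> U} = {}" if "k \<noteq> n" for k
    using U that by (auto simp: fcard_tuple_fset subset_iff)
  have "open U \<longleftrightarrow> openin (distinct_tuples n) {x \<in> topspace (distinct_tuples n). tuple_fset n x \<in> U}"
    unfolding open_fset_def by (metis (no_types, lifting) empty openin_empty)
  moreover have "openin (top_of_set {\<eta>. fcard \<eta> = n}) U \<longleftrightarrow> open U"
    using openin_open_eq[OF open_fset_fcard_eq] U by blast
  ultimately show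
    "openin (distinct_tuples n) {x \<in> topspace (distinct_tuples n). tuple_fset n x \<in> U} =
      openin (top_of_set {\<eta>. fcard \<eta> = n}) U"
    by simp
qed

lemma continuous_on_finsert: "continuous_on (- fset \<eta>) (\<lambda>y. finsert y \<eta>)"
proof -
  obtain xs where xs: "set xs = fset \<eta>" "distinct xs"
    using finite_distinct_list[of "fset \<eta>"] by auto
  define n where "n = Suc (length xs)"
  define g where "g y = restrict ((!) (xs @ [y])) {..<n}" for y
  have g_tuple: "g y \<in> topspace (distinct_tuples n)" if "y \<in> - fset \<eta>" for y
    using nth_in_distinct_tuples[of "xs @ [y]"] xs that by (simp add: g_def n_def)
  have g_eq: "tuple_fset n (g y) = finsert y \<eta>" for y
    using tuple_fset_nth[of "xs @ [y]"] xs
    by (simp add: g_def n_def fset_inject[symmetric] fset_of_list.rep_eq)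
  have "continuous_map (top_of_set (- fset \<eta>)) euclidean (\<lambda>y. g y i)" if "i < n" for i
    using that by (cases "i < length xs") (auto simp: g_def n_def nth_append)
  then have g_cont: "continuous_map (top_of_set (- fset \<eta>)) (distinct_tuples n) g"
    using g_tuple
    by (auto simp: distinct_tuples_def continuous_map_in_subtopology continuous_map_componentwise
        g_def simp del: restrict_apply)
  show ?thesis
    unfolding continuous_on_open_invariant
  proof (intro allI impI)
    fix U :: "'a fset set"
    assume "open U"
    then have "openin (distinct_tuples n) {x \<in> topspace (distinct_tuples n). tuple_fset n x \<in> U}"
      by (simp add: open_fset_def)
    then have "openin (top_of_set (- fset \<eta>)) {y \<in> topspace (top_of_set (- fset \<eta>)).
        g y \<in> {x \<in> topspace (distinct_tuples n). tuple_fset n x \<in> U}}"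
      using g_cont openin_continuous_map_preimage by blast
    also have "{y \<in> topspace (top_of_set (- fset \<eta>)).
        g y \<in> {x \<in> topspace (distinct_tuples n). tuple_fset n x \<in> U}} =
        (\<lambda>y. finsert y \<eta>) -` U \<inter> - fset \<eta>"
      using g_tuple by (auto simp: g_eq)
    finally have "openin (top_of_set (- fset \<eta>)) ((\<lambda>y. finsert y \<eta>) -` U \<inter> - fset \<eta>)" .
    then show "\<exists>A. open A \<and> A \<inter> - fset \<eta> = (\<lambda>y. finsert y \<eta>) -` U \<inter> - fset \<eta>"
      by (auto simp: openin_open)
  qed
qed

lemma borel_measurable_finsert [measurable]:
  "(\<lambda>y :: 'a::t1_space. finsert y \<eta>) \<in> borel \<rightarrow>\<^sub>M borel"
  by (rule borel_measurable_continuous_countable_exceptions[OF _ continuous_on_finsert])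
    (simp add: countable_finite)

section \<open>The BDLP model\<close>

text \<open>
  All coefficients are nonnegative where they are used (\<open>t \<ge> 0\<close>), so no information is lost by
  \<open>ennreal\<close>.
\<close>

definition bdlp_Q ::
  "(real \<Rightarrow> 'a \<Rightarrow> real) \<Rightarrow> ('a \<Rightarrow> 'a \<Rightarrow> real) \<Rightarrow> (real \<Rightarrow> 'a \<Rightarrow> real) \<Rightarrow> ('a \<Rightarrow> 'a \<Rightarrow> real) \<Rightarrow>
    real \<Rightarrow> 'a::euclidean_space fset \<Rightarrow> 'a fset set \<Rightarrow> ennreal" where
  "bdlp_Q m am lam ap t \<eta> A =
    (\<Sum>x\<in>fset \<eta>. ennreal (m t x + (\<Sum>y\<in>fset \<eta> - {x}. am x y)) * indicator A (\<eta> |-| {|x|})) +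
    (\<Sum>x\<in>fset \<eta>. ennreal (lam t x) *
      (\<integral>\<^sup>+y. ennreal (ap x y) * indicator A (finsert y \<eta>) \<partial>lborel))"

definition bdlp_q ::
  "(real \<Rightarrow> 'a \<Rightarrow> real) \<Rightarrow> ('a \<Rightarrow> 'a \<Rightarrow> real) \<Rightarrow> (real \<Rightarrow> 'a \<Rightarrow> real) \<Rightarrow> ('a \<Rightarrow> 'a \<Rightarrow> real) \<Rightarrow>
    real \<Rightarrow> 'a::euclidean_space fset \<Rightarrow> ennreal" where
  "bdlp_q m am lam ap t \<eta> = bdlp_Q m am lam ap t \<eta> UNIV"

text \<open>
  \<open>Q(t, \<eta>, d\<omega>)\<close> as a measure on the Borel sets; \<open>emeasure_bdlp_kernel\<close> shows that \<open>measure_of\<close>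
  does not fall back to the zero measure.
\<close>

definition bdlp_kernel ::
  "(real \<Rightarrow> 'a \<Rightarrow> real) \<Rightarrow> ('a \<Rightarrow> 'a \<Rightarrow> real) \<Rightarrow> (real \<Rightarrow> 'a \<Rightarrow> real) \<Rightarrow> ('a \<Rightarrow> 'a \<Rightarrow> real) \<Rightarrow>
    real \<Rightarrow> 'a::euclidean_space fset \<Rightarrow> 'a fset measure" where
  "bdlp_kernel m am lam ap t \<eta> = measure_of UNIV (sets borel) (bdlp_Q m am lam ap t \<eta>)"

lemma sets_bdlp_kernel [measurable_cong, simp]:
  "sets (bdlp_kernel m am lam ap t \<eta>) = sets borel"
  using sets.sigma_sets_eq[of borel] by (simp add: bdlp_kernel_def)

lemma emeasure_bdlp_kernel:
  fixes ap :: "'a::euclidean_space \<Rightarrow> 'a \<Rightarrow> real"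
  assumes [measurable]: "\<And>x. ap x \<in> borel_measurable borel"
    and A: "A \<in> sets borel"
  shows "emeasure (bdlp_kernel m am lam ap t \<eta>) A = bdlp_Q m am lam ap t \<eta> A"
proof (rule emeasure_measure_of)
  show "positive (sets (bdlp_kernel m am lam ap t \<eta>)) (bdlp_Q m am lam ap t \<eta>)"
    by (simp add: positive_def bdlp_Q_def)
  show "countably_additive (sets (bdlp_kernel m am lam ap t \<eta>)) (bdlp_Q m am lam ap t \<eta>)"
  proof (rule countably_additiveI)
    fix B :: "nat \<Rightarrow> 'a fset set"
    assume "range B \<subseteq> sets (bdlp_kernel m am lam ap t \<eta>)" and disj: "disjoint_family B"
    then have [measurable]: "B i \<in> sets borel" for i by auto
    have int: "(\<Sum>i. \<integral>\<^sup>+y. ennreal (ap x y) * indicator (B i) (finsert y \<eta>) \<partial>lborel) =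
        (\<integral>\<^sup>+y. ennreal (ap x y) * indicator (\<Union>i. B i) (finsert y \<eta>) \<partial>lborel)" for x
      by (subst nn_integral_suminf[symmetric])
        (simp_all add: ennreal_suminf_cmult suminf_indicator[OF disj])
    show "(\<Sum>i. bdlp_Q m am lam ap t \<eta> (B i)) = bdlp_Q m am lam ap t \<eta> (\<Union>i. B i)"
      unfolding bdlp_Q_def
      by (subst suminf_add[symmetric], simp, simp)
        (simp only: suminf_sum[OF summableI] ennreal_suminf_cmult suminf_indicator[OF disj] int)
  qed
qed (use A in \<open>auto simp: bdlp_kernel_def\<close>)

definition bdlp_V :: "'a fset \<Rightarrow> real" where
  "bdlp_V \<eta> = real (fcard \<eta>) + (real (fcard \<eta>))\<^sup>2"

end

theory Submission
  imports Defs
begin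

text \<open>
  The topology of the configuration space is that of a quotient of tuples, and the proof rests on a
  description of it that needs no choice of tuples. Close to a configuration \<open>\<eta>\<close>, every
  configuration \<open>\<zeta>\<close> has the same number of points, one close to each point of \<open>\<eta>\<close>. Sending each
  point of \<open>\<eta>\<close> to its nearest point of \<open>\<zeta>\<close> therefore gives a bijection
  (\<open>eventually_bij_betw_nearest\<close>) that tends to the identity as \<open>\<zeta>\<close> tends to \<open>\<eta>\<close>
  (\<open>tendsto_nearest\<close>). Conversely, moving the points of \<open>\<eta>\<close> by maps that tend to the identity gives
  configurations that tend to \<open>\<eta>\<close> (\<open>tendsto_fimage\<close>). This yields first countability, and it
  identifies the compact sets up to inclusion: a set is contained in a compact one iff its
  configurations have a bounded number of points in a common ball, at pairwise distances bounded
  away from zero (\<open>compact_separated_in\<close>, \<open>compact_subset_separated_in\<close>).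

  (A) Start in a compact set. A death changes none of these three bounds for the worse. A birth
  violates them if the new point is far away, which the integrable majorant of \<open>a\<^sup>+\<close> makes
  improbable, or if it is very close to an old point, which has small probability because \<open>a\<^sup>+\<close> is
  bounded on compact sets. All bounds are uniform over the starting set (\<open>compact_containment\<close>).

  (B) Only births increase \<open>V\<close>, by at most \<open>2 (|\<eta>| + 1)\<close>, at total rate at most \<open>L |\<eta>|\<close>, where
  \<open>L\<close> is a bound for \<open>\<lambda>\<close>. The product is \<open>2 L V(\<eta>)\<close>, so the constant function \<open>c = 2 L\<close> will do
  (\<open>drift_inequality\<close>).

  (C) The integral against the kernel is a finite sum over the points of the configuration
  (\<open>has_bochner_integral_bdlp_kernel\<close>). Along a convergent sequence of configurations, the nearest
  points turn it into a sum over the points of the limit, in which the coefficients converge by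
  continuity and the birth integrals by dominated convergence (\<open>tendsto_birth\<close>).

  (D) The rates of death by competition sum to a quadratic expression in \<open>|\<eta>|\<close>, the other rates to
  a linear one (\<open>exit_rate_le\<close>).
\<close>

section \<open>Convergence of finite configurations\<close>

lemma open_fset_hit:
  fixes V :: "'a::topological_space set"
  assumes "open V"
  shows "open {\<zeta> :: 'a fset. fset \<zeta> \<inter> V \<noteq> {}}"
  unfolding open_fset_def
proof
  fix n
  have "{x \<in> topspace (distinct_tuples n). tuple_fset n x \<in> {\<zeta> :: 'a fset. fset \<zeta> \<inter> V \<noteq> {}}} =
      (\<Union>i\<in>{..<n}. {x \<in> topspace (distinct_tuples n). x i \<in> V})"
    by auto
  moreover have "openin (distinct_tuples n) {x \<in> topspace (distinct_tuples n). x i \<in> V}"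
    if "i < n" for i
  proof -
    have "continuous_map (distinct_tuples n) euclidean (\<lambda>x :: nat \<Rightarrow> 'a. x i)"
      unfolding distinct_tuples_def using that
      by (intro continuous_map_from_subtopology continuous_map_product_projection) auto
    then show ?thesis
      using assms openin_continuous_map_preimage by fastforce
  qed
  ultimately show "openin (distinct_tuples n)
      {x \<in> topspace (distinct_tuples n). tuple_fset n x \<in> {\<zeta> :: 'a fset. fset \<zeta> \<inter> V \<noteq> {}}}"
    by auto
qed

text \<open>
  Distinct limits have disjoint neighbourhoods, and there are only finitely many pairs to separate.
\<close>

lemma eventually_inj_on_tendsto:
  fixes g :: "'i \<Rightarrow> 'a \<Rightarrow> 'b::t2_space"
  assumes "finite A" "inj_on l A" and lim: "\<And>a. a \<in> A \<Longrightarrow> ((\<lambda>k. g k a) \<longlongrightarrow> l a) F"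
  shows "\<forall>\<^sub>F k in F. inj_on (g k) A"
proof -
  have "\<forall>\<^sub>F k in F. g k a \<noteq> g k b" if "a \<in> A" "b \<in> A" "a \<noteq> b" for a b
  proof -
    have "l a \<noteq> l b" using that assms(2) by (auto dest: inj_onD)
    then obtain U V where UV: "open U" "open V" "l a \<in> U" "l b \<in> V" "U \<inter> V = {}"
      using hausdorff by metis
    have "\<forall>\<^sub>F k in F. g k a \<in> U" "\<forall>\<^sub>F k in F. g k b \<in> V"
      using lim that UV topological_tendstoD by blast+
    then show ?thesis
      by eventually_elim (use UV in auto)
  qed
  then have "\<forall>\<^sub>F k in F. a \<noteq> b \<longrightarrow> g k a \<noteq> g k b" if "a \<in> A" "b \<in> A" for a b
    using that by (cases "a = b") simp_all
  then have "\<forall>\<^sub>F k in F. \<forall>a\<in>A. \<forall>b\<in>A. a \<noteq> b \<longrightarrow> g k a \<noteq> g k b"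
    using assms(1) by (simp add: eventually_ball_finite_distrib)
  then show ?thesis
    by eventually_elim (auto simp: inj_on_def)
qed

text \<open>
  A configuration converges as soon as its points do. A neighbourhood of \<open>\<eta>\<close> is open when pulled
  back to tuples, so it contains the images of a whole box around an enumeration \<open>x\<close> of \<open>\<eta>\<close>; the
  moved tuple \<open>g k \<circ> x\<close> eventually lies in this box, and it eventually has distinct entries.
\<close>

lemma tendsto_fimage:
  fixes \<eta> :: "'a::t2_space fset"
  assumes lim: "\<And>x. x |\<in>| \<eta> \<Longrightarrow> ((\<lambda>k. g k x) \<longlongrightarrow> x) F"
  shows "((\<lambda>k. g k |`| \<eta>) \<longlongrightarrow> \<eta>) F"
proof (rule topological_tendstoI)
  fix S :: "'a fset set"
  assume S: "open S" "\<eta> \<in> S"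
  define n where "n = fcard \<eta>"
  obtain x where x: "x \<in> topspace (distinct_tuples n)" "tuple_fset n x = \<eta>"
    using tuple_fset_surj n_def by metis
  have x_in: "x i |\<in>| \<eta>" if "i < n" for i
    using x(2) that by auto
  define P where "P = {y \<in> topspace (distinct_tuples n). tuple_fset n y \<in> S}"
  have "openin (distinct_tuples n) P"
    using S(1) by (simp add: open_fset_def P_def)
  then obtain W where W: "openin (product_topology (\<lambda>_. euclidean) {..<n}) W"
    and P_eq: "P = W \<inter> {y. inj_on y {..<n}}"
    unfolding distinct_tuples_def openin_subtopology by blast
  have "x \<in> W"
    using x S P_eq by (auto simp: P_def)
  then have "\<exists>U. finite {i \<in> {..<n}. U i \<noteq> topspace euclidean} \<and> (\<forall>i\<in>{..<n}. openin euclidean (U i)) \<and>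
      x \<in> Pi\<^sub>E {..<n} U \<and> Pi\<^sub>E {..<n} U \<subseteq> W"
    using W[unfolded openin_product_topology_alt] by (rule bspec[rotated])
  then obtain U where U: "\<And>i. i < n \<Longrightarrow> open (U i)" "x \<in> Pi\<^sub>E {..<n} U" "Pi\<^sub>E {..<n} U \<subseteq> W"
    by auto
  have "\<forall>i\<in>{..<n}. \<forall>\<^sub>F k in F. g k (x i) \<in> U i"
  proof
    fix i assume "i \<in> {..<n}"
    then show "\<forall>\<^sub>F k in F. g k (x i) \<in> U i"
      using topological_tendstoD[OF lim[OF x_in] U(1)] U(2) by auto
  qed
  then have "\<forall>\<^sub>F k in F. \<forall>i\<in>{..<n}. g k (x i) \<in> U i"
    by (simp add: eventually_ball_finite_distrib)
  moreover have "\<forall>\<^sub>F k in F. inj_on (g k) (fset \<eta>)"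
    by (rule eventually_inj_on_tendsto[where l = "\<lambda>x. x"]) (use lim in auto)
  ultimately show "\<forall>\<^sub>F k in F. g k |`| \<eta> \<in> S"
  proof eventually_elim
    fix k assume k: "\<forall>i\<in>{..<n}. g k (x i) \<in> U i" "inj_on (g k) (fset \<eta>)"
    define y where "y = restrict (g k \<circ> x) {..<n}"
    have "y \<in> Pi\<^sub>E {..<n} U"
      using k(1) by (auto simp: y_def)
    then have "y \<in> W"
      using U(3) by blast
    moreover have "inj_on y {..<n}"
    proof -
      have "inj_on x {..<n}"
        using x(1) by (simp add: distinct_tuples_def)
      moreover have "x ` {..<n} = fset \<eta>"
        using fset_tuple_fset[of n x] unfolding x(2) by (rule sym)
      ultimately show ?thesis
        using k(2) unfolding y_def inj_on_restrict_eq by (intro comp_inj_on) simp_all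
    qed
    ultimately have "tuple_fset n y \<in> S"
      using P_eq by (auto simp: P_def)
    moreover have "fset (tuple_fset n y) = fset (g k |`| tuple_fset n x)"
      by (simp add: y_def image_comp)
    then have "tuple_fset n y = g k |`| \<eta>"
      by (simp only: fset_inject x(2))
    ultimately show "g k |`| \<eta> \<in> S" by simp
  qed
qed

text \<open>
  The converse to \<open>tendsto_fimage\<close>: near \<open>\<eta>\<close>, the points of a configuration \<open>\<zeta>\<close> can be
  labelled by the points of \<open>\<eta>\<close>, and the label of a point is the point of \<open>\<eta>\<close> that it is close
  to. Choosing a nearest point of \<open>\<zeta>\<close> gives one labelling that serves for all \<open>\<zeta>\<close> at once.
  For \<open>\<zeta> = {||}\<close> the value is arbitrary.
\<close>

definition nearest :: "'a::metric_space fset \<Rightarrow> 'a \<Rightarrow> 'a" where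
  "nearest \<zeta> x = arg_min_on (\<lambda>z. dist z x) (fset \<zeta>)"

lemma nearest_fmember: "\<zeta> \<noteq> {||} \<Longrightarrow> nearest \<zeta> x |\<in>| \<zeta>"
  unfolding nearest_def by (rule arg_min_if_finite(1)) auto

lemma dist_nearest_le: "z |\<in>| \<zeta> \<Longrightarrow> dist (nearest \<zeta> x) x \<le> dist z x"
  unfolding nearest_def by (rule arg_min_least) auto

text \<open>
  Hitting a small ball around \<open>x\<close> is an open condition on \<open>\<zeta>\<close> that \<open>\<eta>\<close> satisfies, and the point
  of \<open>\<zeta>\<close> nearest to \<open>x\<close> can only be closer to \<open>x\<close> than the point in the ball.
\<close>

lemma tendsto_nearest:
  assumes "x |\<in>| \<eta>"
  shows "((\<lambda>\<zeta>. nearest \<zeta> x) \<longlongrightarrow> x) (nhds \<eta>)"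
proof (rule tendstoI)
  fix e :: real assume "e > 0"
  then have "\<forall>\<^sub>F \<zeta> in nhds \<eta>. \<zeta> \<in> {\<zeta>. fset \<zeta> \<inter> ball x e \<noteq> {}}"
    using assms by (intro eventually_nhds_in_open open_fset_hit) auto
  then show "\<forall>\<^sub>F \<zeta> in nhds \<eta>. dist (nearest \<zeta> x) x < e"
  proof eventually_elim
    fix \<zeta> assume "\<zeta> \<in> {\<zeta>. fset \<zeta> \<inter> ball x e \<noteq> {}}"
    then obtain z where "z |\<in>| \<zeta>" "dist z x < e" by (auto simp: dist_commute)
    then show "dist (nearest \<zeta> x) x < e"
      using dist_nearest_le[of z \<zeta> x] by simp
  qed
qed

lemma bij_betw_nearest:
  assumes "inj_on (nearest \<zeta>) (fset \<eta>)" "fcard \<zeta> = fcard \<eta>"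
  shows "bij_betw (nearest \<zeta>) (fset \<eta>) (fset \<zeta>)"
proof (cases "\<zeta> = {||}")
  case True
  then show ?thesis using assms(2) by (auto simp: bij_betw_def fcard.rep_eq)
next
  case False
  then have "nearest \<zeta> ` fset \<eta> \<subseteq> fset \<zeta>"
    using nearest_fmember by blast
  then have "nearest \<zeta> ` fset \<eta> = fset \<zeta>"
    using assms by (intro card_subset_eq) (auto simp: card_image fcard.rep_eq)
  then show ?thesis using assms(1) by (simp add: bij_betw_def)
qed

text \<open>
  The labels are eventually distinct because their limits are, and \<open>\<zeta>\<close> eventually has exactly as
  many points as \<open>\<eta>\<close>, so that no point of \<open>\<zeta>\<close> stays without a label.
\<close>

lemma eventually_bij_betw_nearest:
  "\<forall>\<^sub>F \<zeta> in nhds \<eta>. bij_betw (nearest \<zeta>) (fset \<eta>) (fset \<zeta>)"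
proof -
  have "\<forall>\<^sub>F \<zeta> in nhds \<eta>. inj_on (nearest \<zeta>) (fset \<eta>)"
    by (rule eventually_inj_on_tendsto[where l = "\<lambda>x. x"]) (use tendsto_nearest in auto)
  moreover have "\<forall>\<^sub>F \<zeta> in nhds \<eta>. \<zeta> \<in> {\<zeta>. fcard \<zeta> = fcard \<eta>}"
    using open_fset_fcard_eq by (rule eventually_nhds_in_open) simp
  ultimately show ?thesis
    by eventually_elim (use bij_betw_nearest in auto)
qed

text \<open>
  The basis consists of the configurations with \<open>fcard \<eta>\<close> points that hit each ball of radius
  \<open>1 / (k + 1)\<close> around a point of \<open>\<eta>\<close>. If none of these sets were contained in a neighbourhood
  \<open>S\<close>, counterexamples \<open>\<zeta> k\<close> would be the images of \<open>\<eta>\<close> under their labellings, whose points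
  converge, so that \<open>tendsto_fimage\<close> puts \<open>\<zeta> k\<close> into \<open>S\<close>. First countability is what allows
  continuity on the configuration space to be tested on sequences, hence by dominated convergence.
\<close>

instance fset :: (metric_space) first_countable_topology
proof
  fix \<eta> :: "'a fset"
  define A where "A k = {\<zeta>. fcard \<zeta> = fcard \<eta>} \<inter>
    (\<Inter>x\<in>fset \<eta>. {\<zeta>. fset \<zeta> \<inter> ball x (1 / real (Suc k)) \<noteq> {}})" for k
  have A: "\<eta> \<in> A k \<and> open (A k)" for k
    by (auto simp: A_def intro!: open_Int open_INT open_fset_fcard_eq open_fset_hit)
  moreover have "\<exists>k. A k \<subseteq> S" if S: "open S" "\<eta> \<in> S" for S
  proof (rule ccontr)
    assume "\<nexists>k. A k \<subseteq> S"
    then have "\<forall>k. \<exists>\<zeta>. \<zeta> \<in> A k \<and> \<zeta> \<notin> S" by blast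
    then obtain \<zeta> where \<zeta>: "\<And>k. \<zeta> k \<in> A k" "\<And>k. \<zeta> k \<notin> S"
      by metis
    have lim: "((\<lambda>k. nearest (\<zeta> k) x) \<longlongrightarrow> x) sequentially" if "x |\<in>| \<eta>" for x
    proof (rule metric_LIMSEQ_I)
      fix e :: real assume "e > 0"
      then obtain N where N: "1 / real (Suc N) < e"
        using nat_approx_posE by blast
      have "dist (nearest (\<zeta> k) x) x < e" if "k \<ge> N" for k
      proof -
        have "fset (\<zeta> k) \<inter> ball x (1 / real (Suc k)) \<noteq> {}"
          using \<zeta>(1)[of k] \<open>x |\<in>| \<eta>\<close> unfolding A_def by blast
        then obtain z where "z |\<in>| \<zeta> k" "dist z x < 1 / real (Suc k)"
          by (auto simp: dist_commute)
        moreover have "1 / real (Suc k) \<le> 1 / real (Suc N)"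
          using that by (simp add: field_simps)
        ultimately show ?thesis
          using N dist_nearest_le[of z "\<zeta> k" x] by linarith
      qed
      then show "\<exists>N. \<forall>k\<ge>N. dist (nearest (\<zeta> k) x) x < e" by blast
    qed
    have "\<forall>\<^sub>F k in sequentially. nearest (\<zeta> k) |`| \<eta> \<in> S"
      using tendsto_fimage[OF lim] S by (rule topological_tendstoD)
    moreover have "\<forall>\<^sub>F k in sequentially. inj_on (nearest (\<zeta> k)) (fset \<eta>)"
      by (rule eventually_inj_on_tendsto[where l = "\<lambda>x. x"]) (use lim in auto)
    ultimately have "\<forall>\<^sub>F k::nat in sequentially. False"
    proof eventually_elim
      fix k assume k: "nearest (\<zeta> k) |`| \<eta> \<in> S" "inj_on (nearest (\<zeta> k)) (fset \<eta>)"
      have "bij_betw (nearest (\<zeta> k)) (fset \<eta>) (fset (\<zeta> k))"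
        using k(2) \<zeta>(1)[of k] by (intro bij_betw_nearest) (auto simp: A_def)
      then have "nearest (\<zeta> k) |`| \<eta> = \<zeta> k"
        by (simp add: bij_betw_def fset_inject[symmetric])
      then show False using k(1) \<zeta>(2)[of k] by simp
    qed
    then show False by simp
  qed
  ultimately show "\<exists>A. (\<forall>i::nat. \<eta> \<in> A i \<and> open (A i)) \<and>
      (\<forall>S. open S \<and> \<eta> \<in> S \<longrightarrow> (\<exists>i. A i \<subseteq> S))"
    by (intro exI[of _ A]) blast
qed

section \<open>Compact sets of configurations\<close>

text \<open>
  Compactness of a set of configurations requires control of three things: the number of points,
  their escape to infinity, and their collisions, since configurations in which two points collide
  have no limit in the space. These sets control all three.
\<close>

definition separated_in :: "'a::metric_space set \<Rightarrow> nat \<Rightarrow> real \<Rightarrow> 'a fset set" where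
  "separated_in K N \<delta> =
    {\<zeta>. fcard \<zeta> \<le> N \<and> fset \<zeta> \<subseteq> K \<and> (\<forall>x\<in>fset \<zeta>. \<forall>y\<in>fset \<zeta>. x \<noteq> y \<longrightarrow> \<delta> \<le> dist x y)}"

text \<open>
  The tuples with entries in \<open>K\<close> form a compact product, and those with pairwise distances at
  least \<open>\<delta>\<close> are a closed part of it. This part lies in the domain of the quotient map because
  \<open>\<delta> > 0\<close> keeps the entries distinct, and its continuous image consists of the separated
  configurations with \<open>n\<close> points.
\<close>

lemma compact_separated_in:
  fixes K :: "'a::metric_space set"
  assumes K: "compact K" and "\<delta> > 0"
  shows "compact (separated_in K N \<delta>)"
proof -
  define S where
    "S n = {x :: nat \<Rightarrow> 'a. \<forall>i\<in>{..<n}. \<forall>j\<in>{..<n}. i \<noteq> j \<longrightarrow> \<delta> \<le> dist (x i) (x j)}" for n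
  define P where "P n = product_topology (\<lambda>_. euclidean :: 'a topology) {..<n}" for n :: nat
  have "compact (tuple_fset n ` (topspace (P n) \<inter> S n \<inter> Pi\<^sub>E {..<n} (\<lambda>_. K)))" for n
  proof -
    have "closedin (P n) {x \<in> topspace (P n). i \<noteq> j \<longrightarrow> \<delta> \<le> dist (x i) (x j)}"
      if "i < n" "j < n" for i j
    proof (cases "i = j")
      case False
      have "continuous_map (P n) euclidean (\<lambda>x. x i)" "continuous_map (P n) euclidean (\<lambda>x. x j)"
        unfolding P_def using that by (auto intro: continuous_map_product_projection)
      then have c: "continuous_map (P n) euclidean (\<lambda>x. dist (x i) (x j))"
        by (simp add: continuous_map_atin tendsto_dist)
      have "closedin (P n) {x \<in> topspace (P n). dist (x i) (x j) \<in> {\<delta>..}}"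
        by (rule closedin_continuous_map_preimage[OF c]) simp
      then show ?thesis using False by simp
    qed simp
    then have "closedin (P n) (\<Inter>(insert (topspace (P n))
        ((\<lambda>(i, j). {x \<in> topspace (P n). i \<noteq> j \<longrightarrow> \<delta> \<le> dist (x i) (x j)}) ` ({..<n} \<times> {..<n}))))"
      by (intro closedin_Inter) auto
    also have "\<dots> = topspace (P n) \<inter> S n"
      by (auto simp: S_def)
    finally have "closedin (P n) (topspace (P n) \<inter> S n)" .
    then have "compactin (P n) (topspace (P n) \<inter> S n \<inter> Pi\<^sub>E {..<n} (\<lambda>_. K))"
      by (rule closed_Int_compactin) (use K in \<open>auto simp: P_def compactin_PiE\<close>)
    moreover have "S n \<subseteq> {x. inj_on x {..<n}}"
      using \<open>\<delta> > 0\<close> by (force simp: S_def inj_on_def)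
    ultimately have "compactin (distinct_tuples n) (topspace (P n) \<inter> S n \<inter> Pi\<^sub>E {..<n} (\<lambda>_. K))"
      unfolding distinct_tuples_def P_def compactin_subtopology by auto
    from image_compactin[OF this quotient_imp_continuous_map[OF quotient_map_tuple_fset]]
    show ?thesis by (simp add: compactin_subtopology)
  qed
  then have "compact (\<Union>n\<in>{..N}. tuple_fset n ` (topspace (P n) \<inter> S n \<inter> Pi\<^sub>E {..<n} (\<lambda>_. K)))"
    by (intro compact_UN) auto
  also have "(\<Union>n\<in>{..N}. tuple_fset n ` (topspace (P n) \<inter> S n \<inter> Pi\<^sub>E {..<n} (\<lambda>_. K))) =
      separated_in K N \<delta>"
  proof (intro set_eqI iffI)
    fix \<zeta> :: "'a fset"
    assume "\<zeta> \<in> (\<Union>n\<in>{..N}. tuple_fset n ` (topspace (P n) \<inter> S n \<inter> Pi\<^sub>E {..<n} (\<lambda>_. K)))"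
    then obtain n x where n: "n \<le> N" "\<zeta> = tuple_fset n x" "x \<in> S n" "x \<in> Pi\<^sub>E {..<n} (\<lambda>_. K)"
      by auto
    have "fcard \<zeta> \<le> N"
      using n(1,2) card_image_le[of "{..<n}" x] by (simp add: fcard.rep_eq)
    moreover have "\<delta> \<le> dist u v" if uv: "u \<in> fset \<zeta>" "v \<in> fset \<zeta>" "u \<noteq> v" for u v
    proof -
      obtain i j where "i < n" "j < n" "u = x i" "v = x j"
        using uv(1,2) n(2) by auto
      moreover from this have "i \<noteq> j" using uv(3) by auto
      ultimately show ?thesis using n(3) by (simp add: S_def)
    qed
    moreover have "fset \<zeta> \<subseteq> K"
      using n(2,4) by auto
    ultimately show "\<zeta> \<in> separated_in K N \<delta>"
      by (simp add: separated_in_def)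
  next
    fix \<zeta> assume \<zeta>: "\<zeta> \<in> separated_in K N \<delta>"
    define n where "n = fcard \<zeta>"
    obtain x where x: "x \<in> topspace (distinct_tuples n)" "tuple_fset n x = \<zeta>"
      using tuple_fset_surj n_def by metis
    have "x \<in> topspace (P n)" and inj: "inj_on x {..<n}"
      using x(1) by (auto simp: distinct_tuples_def P_def)
    have im: "fset \<zeta> = x ` {..<n}"
      using fset_tuple_fset[of n x] unfolding x(2) .
    note \<open>x \<in> topspace (P n)\<close>
    moreover have "x \<in> Pi\<^sub>E {..<n} (\<lambda>_. K)"
      using \<zeta> im \<open>x \<in> topspace (P n)\<close> by (auto simp: separated_in_def P_def)
    moreover have "x \<in> S n"
      unfolding S_def
    proof (intro CollectI ballI impI)
      fix i j assume ij: "i \<in> {..<n}" "j \<in> {..<n}" "i \<noteq> j"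
      then have "x i \<noteq> x j" using inj by (auto dest: inj_onD)
      moreover have "x i \<in> fset \<zeta>" "x j \<in> fset \<zeta>" using im ij by auto
      ultimately show "\<delta> \<le> dist (x i) (x j)"
        using \<zeta> by (auto simp: separated_in_def)
    qed
    moreover have "n \<le> N"
      using \<zeta> by (simp add: separated_in_def n_def)
    ultimately show "\<zeta> \<in> (\<Union>n\<in>{..N}. tuple_fset n ` (topspace (P n) \<inter> S n \<inter> Pi\<^sub>E {..<n} (\<lambda>_. K)))"
      using x(2) by blast
  qed
  finally show ?thesis .
qed

text \<open>
  The sets \<open>U k\<close> of configurations with at most \<open>k\<close> points, all of norm below \<open>k\<close> and at pairwise
  distances above \<open>1 / (k + 1)\<close>, are open, increase with \<open>k\<close> and cover the whole space. So one of
  them contains \<open>B\<close>.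
\<close>

lemma compact_subset_separated_in:
  fixes B :: "'a::real_normed_vector fset set"
  assumes "compact B"
  obtains N R \<delta> where "\<delta> > 0" "B \<subseteq> separated_in (cball 0 R) N \<delta>"
proof -
  define U where "U k = {\<zeta> :: 'a fset. fcard \<zeta> \<le> k \<and> (\<forall>x\<in>fset \<zeta>. norm x < real k) \<and>
    (\<forall>x\<in>fset \<zeta>. \<forall>y\<in>fset \<zeta>. x \<noteq> y \<longrightarrow> 1 / real (Suc k) < dist x y)}" for k
  have U_mono: "U k \<subseteq> U l" if "k \<le> l" for k l
  proof -
    have "1 / real (Suc l) \<le> 1 / real (Suc k)"
      using that by (simp add: field_simps)
    then show ?thesis
      using that by (fastforce simp: U_def)
  qed
  have U_open: "open (U k)" for k
  proof (subst open_subopen, intro ballI)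
    fix \<eta> assume \<eta>: "\<eta> \<in> U k"
    have "\<forall>\<^sub>F \<zeta> in nhds \<eta>. norm (nearest \<zeta> x) < real k" if "x \<in> fset \<eta>" for x
      using order_tendstoD(2)[OF tendsto_norm[OF tendsto_nearest]] that \<eta> by (auto simp: U_def)
    then have 1: "\<forall>\<^sub>F \<zeta> in nhds \<eta>. \<forall>x\<in>fset \<eta>. norm (nearest \<zeta> x) < real k"
      by (simp add: eventually_ball_finite)
    have "\<forall>\<^sub>F \<zeta> in nhds \<eta>. x \<noteq> y \<longrightarrow> 1 / real (Suc k) < dist (nearest \<zeta> x) (nearest \<zeta> y)"
      if "x \<in> fset \<eta>" "y \<in> fset \<eta>" for x y
    proof (cases "x = y")
      case False
      then have "1 / real (Suc k) < dist x y"
        using \<eta> that by (auto simp: U_def)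
      then show ?thesis
        using order_tendstoD(1)[OF tendsto_dist[OF tendsto_nearest tendsto_nearest]] that
        by (fastforce elim: eventually_mono)
    qed simp
    then have 2: "\<forall>\<^sub>F \<zeta> in nhds \<eta>. \<forall>x\<in>fset \<eta>. \<forall>y\<in>fset \<eta>.
        x \<noteq> y \<longrightarrow> 1 / real (Suc k) < dist (nearest \<zeta> x) (nearest \<zeta> y)"
      by (simp add: eventually_ball_finite)
    have "\<forall>\<^sub>F \<zeta> in nhds \<eta>. \<zeta> \<in> U k"
      using 1 2 eventually_bij_betw_nearest
    proof eventually_elim
      fix \<zeta> assume *: "\<forall>x\<in>fset \<eta>. norm (nearest \<zeta> x) < real k"
        "\<forall>x\<in>fset \<eta>. \<forall>y\<in>fset \<eta>. x \<noteq> y \<longrightarrow> 1 / real (Suc k) < dist (nearest \<zeta> x) (nearest \<zeta> y)"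
        "bij_betw (nearest \<zeta>) (fset \<eta>) (fset \<zeta>)"
      have im: "fset \<zeta> = nearest \<zeta> ` fset \<eta>" "card (fset \<zeta>) = card (fset \<eta>)"
        using *(3) bij_betw_same_card[OF *(3)] by (auto simp: bij_betw_def)
      have "fcard \<zeta> \<le> k"
        using im(2) \<eta> by (simp add: U_def fcard.rep_eq)
      moreover have "\<forall>x\<in>fset \<zeta>. norm x < real k"
        unfolding im(1) using *(1) by blast
      moreover have "\<forall>x\<in>fset \<zeta>. \<forall>y\<in>fset \<zeta>. x \<noteq> y \<longrightarrow> 1 / real (Suc k) < dist x y"
        unfolding im(1)
      proof (intro ballI impI)
        fix x y assume xy: "x \<in> nearest \<zeta> ` fset \<eta>" "y \<in> nearest \<zeta> ` fset \<eta>" "x \<noteq> y"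
        then obtain u v where "u \<in> fset \<eta>" "v \<in> fset \<eta>" "x = nearest \<zeta> u" "y = nearest \<zeta> v"
          by blast
        then show "1 / real (Suc k) < dist x y"
          using *(2) xy(3) by metis
      qed
      ultimately show "\<zeta> \<in> U k"
        by (simp add: U_def)
    qed
    then show "\<exists>T. open T \<and> \<eta> \<in> T \<and> T \<subseteq> U k"
      by (auto simp: eventually_nhds)
  qed
  have cover: "\<exists>k. \<eta> \<in> U k" for \<eta>
  proof -
    \<comment> \<open>Sums serve as crude upper bounds for the maxima over \<open>\<eta>\<close>, also when \<open>\<eta>\<close> is empty;
      the terms \<open>1 / dist x x = 0\<close> do no harm.\<close>
    define n where "n = (\<Sum>x\<in>fset \<eta>. nat \<lceil>norm x\<rceil> + 1)"
    define D where "D = (\<Sum>x\<in>fset \<eta>. \<Sum>y\<in>fset \<eta>. nat \<lceil>1 / dist x y\<rceil>)"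
    define k where "k = fcard \<eta> + n + D"
    have "norm x < real k" if "x \<in> fset \<eta>" for x
    proof -
      have "nat \<lceil>norm x\<rceil> + 1 \<le> n"
        unfolding n_def using that by (intro member_le_sum) auto
      then show ?thesis
        unfolding k_def by linarith
    qed
    moreover have "1 / real (Suc k) < dist x y" if xy: "x \<in> fset \<eta>" "y \<in> fset \<eta>" "x \<noteq> y" for x y
    proof -
      have "nat \<lceil>1 / dist x y\<rceil> \<le> (\<Sum>y\<in>fset \<eta>. nat \<lceil>1 / dist x y\<rceil>)"
        using xy by (intro member_le_sum) auto
      also have "\<dots> \<le> D"
        unfolding D_def using xy by (intro member_le_sum) auto
      finally have "1 / dist x y < real (Suc k)"
        unfolding k_def by linarith
      moreover have "dist x y > 0" using xy by simp
      ultimately show ?thesis by (simp add: field_simps)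
    qed
    ultimately show ?thesis
      by (intro exI[of _ k]) (auto simp: U_def k_def)
  qed
  have "B \<subseteq> (\<Union>k. U k)"
    using cover by auto
  from compactE_image[OF assms U_open this]
  obtain C where C: "finite C" "B \<subseteq> (\<Union>k\<in>C. U k)" .
  define k where "k = Max (insert 0 C)"
  have "B \<subseteq> U k"
  proof
    fix \<eta> assume "\<eta> \<in> B"
    then obtain l where "l \<in> C" "\<eta> \<in> U l" using C(2) by blast
    moreover have "l \<le> k" using \<open>l \<in> C\<close> C(1) by (simp add: k_def)
    ultimately show "\<eta> \<in> U k" using U_mono by blast
  qed
  also have "U k \<subseteq> separated_in (cball 0 (real k)) k (1 / real (Suc k))"
    by (auto simp: U_def separated_in_def less_imp_le)
  finally show thesis
    using that[of "1 / real (Suc k)" "real k" k] by simp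
qed

section \<open>Integration against the transition kernel\<close>

text \<open>
  For indicators this is the definition of the kernel, and both sides are linear and continuous
  along increasing sequences in \<open>f\<close>.
\<close>

lemma nn_integral_bdlp_kernel:
  fixes ap :: "'a::euclidean_space \<Rightarrow> 'a \<Rightarrow> real" and f :: "'a fset \<Rightarrow> ennreal"
  assumes ap [measurable]: "\<And>x. ap x \<in> borel_measurable borel"
    and f: "f \<in> borel_measurable borel"
  shows "(\<integral>\<^sup>+\<omega>. f \<omega> \<partial>bdlp_kernel m am lam ap t \<eta>) =
    (\<Sum>x\<in>fset \<eta>. ennreal (m t x + (\<Sum>y\<in>fset \<eta> - {x}. am x y)) * f (\<eta> |-| {|x|})) +
    (\<Sum>x\<in>fset \<eta>. ennreal (lam t x) *
      (\<integral>\<^sup>+y. ennreal (ap x y) * f (finsert y \<eta>) \<partial>lborel))"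
  using f
proof (induct rule: borel_measurable_induct)
  case (cong f g)
  then show ?case by (simp cong: nn_integral_cong)
next
  case (set A)
  then show ?case
    by (simp add: emeasure_bdlp_kernel bdlp_Q_def)
next
  case (mult u c)
  then have [measurable]: "u \<in> borel_measurable borel" by simp
  have "(\<integral>\<^sup>+y. ennreal (ap x y) * (c * u (finsert y \<eta>)) \<partial>lborel) =
      c * (\<integral>\<^sup>+y. ennreal (ap x y) * u (finsert y \<eta>) \<partial>lborel)" for x
    by (subst nn_integral_cmult[symmetric]) (simp_all add: ac_simps)
  moreover have "(\<integral>\<^sup>+\<omega>. c * u \<omega> \<partial>bdlp_kernel m am lam ap t \<eta>) =
      c * (\<integral>\<^sup>+\<omega>. u \<omega> \<partial>bdlp_kernel m am lam ap t \<eta>)"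
    by (rule nn_integral_cmult) simp
  ultimately show ?case
    by (simp add: mult(4) distrib_left sum_distrib_left ac_simps)
next
  case (add u v)
  then have [measurable]: "u \<in> borel_measurable borel" "v \<in> borel_measurable borel" by simp_all
  have "(\<integral>\<^sup>+y. ennreal (ap x y) * (v (finsert y \<eta>) + u (finsert y \<eta>)) \<partial>lborel) =
      (\<integral>\<^sup>+y. ennreal (ap x y) * v (finsert y \<eta>) \<partial>lborel) +
      (\<integral>\<^sup>+y. ennreal (ap x y) * u (finsert y \<eta>) \<partial>lborel)" for x
    by (subst nn_integral_add[symmetric]) (simp_all add: distrib_left)
  moreover have "(\<integral>\<^sup>+\<omega>. v \<omega> + u \<omega> \<partial>bdlp_kernel m am lam ap t \<eta>) =
      (\<integral>\<^sup>+\<omega>. v \<omega> \<partial>bdlp_kernel m am lam ap t \<eta>) + (\<integral>\<^sup>+\<omega>. u \<omega> \<partial>bdlp_kernel m am lam ap t \<eta>)"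
    by (rule nn_integral_add) simp_all
  ultimately show ?case
    by (simp add: add(3) add(7) distrib_left distrib_right sum.distrib ac_simps)
next
  case (seq U)
  then have [measurable]: "\<And>i. U i \<in> borel_measurable borel" by simp
  have mono: "U i \<omega> \<le> U j \<omega>" if "i \<le> j" for i j \<omega>
    using seq(4) that by (auto simp: incseq_def le_fun_def)
  have inc: "incseq (\<lambda>i. U i \<omega>)" for \<omega>
    using mono by (simp add: incseq_def)
  have inc_int: "incseq (\<lambda>i. \<integral>\<^sup>+y. ennreal (ap x y) * U i (finsert y \<eta>) \<partial>lborel)" for x
    by (intro incseq_SucI nn_integral_mono mult_left_mono mono) simp_all
  have int: "(\<integral>\<^sup>+y. ennreal (ap x y) * (SUP i. U i (finsert y \<eta>)) \<partial>lborel) =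
      (SUP i. \<integral>\<^sup>+y. ennreal (ap x y) * U i (finsert y \<eta>) \<partial>lborel)" for x
    unfolding SUP_mult_left_ennreal
    by (intro nn_integral_monotone_convergence_SUP)
      (auto simp: incseq_def le_fun_def intro!: mult_left_mono mono)
  have "(\<integral>\<^sup>+\<omega>. (SUP i. U i \<omega>) \<partial>bdlp_kernel m am lam ap t \<eta>) =
      (SUP i. \<integral>\<^sup>+\<omega>. U i \<omega> \<partial>bdlp_kernel m am lam ap t \<eta>)"
    by (intro nn_integral_monotone_convergence_SUP seq(4)) simp
  also have "\<dots> =
      (SUP i. \<Sum>x\<in>fset \<eta>. ennreal (m t x + (\<Sum>y\<in>fset \<eta> - {x}. am x y)) * U i (\<eta> |-| {|x|})) +
      (SUP i. \<Sum>x\<in>fset \<eta>. ennreal (lam t x) *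
        (\<integral>\<^sup>+y. ennreal (ap x y) * U i (finsert y \<eta>) \<partial>lborel))"
    unfolding seq(3) using inc_int
    by (intro ennreal_SUP_add)
      (auto simp: incseq_def intro!: sum_mono mult_left_mono mono)
  also have "\<dots> =
      (\<Sum>x\<in>fset \<eta>. ennreal (m t x + (\<Sum>y\<in>fset \<eta> - {x}. am x y)) * (SUP i. U i (\<eta> |-| {|x|}))) +
      (\<Sum>x\<in>fset \<eta>. ennreal (lam t x) *
        (SUP i. \<integral>\<^sup>+y. ennreal (ap x y) * U i (finsert y \<eta>) \<partial>lborel))"
    unfolding SUP_mult_left_ennreal using inc_int
    by (intro arg_cong2[where f = "(+)"] ennreal_SUP_sum)
      (auto simp: incseq_def intro!: mult_left_mono mono)
  finally show ?case
    by (simp add: int image_comp)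
qed

text \<open>
  The real-valued counterpart of the sums in \<open>nn_integral_bdlp_kernel\<close>. It involves only sums over
  \<open>\<eta>\<close> and Lebesgue integrals over the position of the new point, so its continuity can be examined
  term by term.
\<close>

definition bdlp_integral ::
  "(real \<Rightarrow> 'a \<Rightarrow> real) \<Rightarrow> ('a \<Rightarrow> 'a \<Rightarrow> real) \<Rightarrow> (real \<Rightarrow> 'a \<Rightarrow> real) \<Rightarrow> ('a \<Rightarrow> 'a \<Rightarrow> real) \<Rightarrow>
    real \<Rightarrow> 'a::euclidean_space fset \<Rightarrow> ('a fset \<Rightarrow> real) \<Rightarrow> real" where
  "bdlp_integral m am lam ap t \<eta> F =
    (\<Sum>x\<in>fset \<eta>. (m t x + (\<Sum>y\<in>fset \<eta> - {x}. am x y)) * F (\<eta> |-| {|x|})) +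
    (\<Sum>x\<in>fset \<eta>. lam t x * (\<integral>y. ap x y * F (finsert y \<eta>) \<partial>lborel))"

text \<open>
  Nonnegative integrands are covered by \<open>nn_integral_bdlp_kernel\<close>; in general the positive and the
  negative part are subtracted.
\<close>

lemma has_bochner_integral_bdlp_kernel:
  fixes ap :: "'a::euclidean_space \<Rightarrow> 'a \<Rightarrow> real"
  assumes m: "\<And>x. 0 \<le> m t x" and am: "\<And>x y. 0 \<le> am x y" and lam: "\<And>x. 0 \<le> lam t x"
    and ap: "\<And>x y. 0 \<le> ap x y" and ap_meas [measurable]: "\<And>x. ap x \<in> borel_measurable borel"
    and F [measurable]: "F \<in> borel_measurable borel"
    and int: "\<And>x. x |\<in>| \<eta> \<Longrightarrow> integrable lborel (\<lambda>y. ap x y * F (finsert y \<eta>))"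
  shows "has_bochner_integral (bdlp_kernel m am lam ap t \<eta>) F (bdlp_integral m am lam ap t \<eta> F)"
proof -
  have nonneg_case: "has_bochner_integral (bdlp_kernel m am lam ap t \<eta>) G
      (bdlp_integral m am lam ap t \<eta> G)"
    if [measurable]: "G \<in> borel_measurable borel" and G: "\<And>\<omega>. 0 \<le> G \<omega>"
      and G_int: "\<And>x. x |\<in>| \<eta> \<Longrightarrow> integrable lborel (\<lambda>y. ap x y * G (finsert y \<eta>))"
    for G :: "'a fset \<Rightarrow> real"
  proof (rule has_bochner_integral_nn_integral)
    have d: "0 \<le> m t x + (\<Sum>y\<in>fset \<eta> - {x}. am x y)" for x
      using m am by (simp add: sum_nonneg)
    have i: "0 \<le> (\<integral>y. ap x y * G (finsert y \<eta>) \<partial>lborel)" for x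
      using ap G by (intro Bochner_Integration.integral_nonneg) auto
    show "0 \<le> bdlp_integral m am lam ap t \<eta> G"
      unfolding bdlp_integral_def
      by (rule add_nonneg_nonneg[OF sum_nonneg[OF mult_nonneg_nonneg[OF d G]]
            sum_nonneg[OF mult_nonneg_nonneg[OF lam i]]])
    have birth: "(\<integral>\<^sup>+y. ennreal (ap x y) * ennreal (G (finsert y \<eta>)) \<partial>lborel) =
        ennreal (\<integral>y. ap x y * G (finsert y \<eta>) \<partial>lborel)" if "x \<in> fset \<eta>" for x
      using G_int[OF that] ap G
      by (subst nn_integral_eq_integral[symmetric]) (simp_all add: ennreal_mult)
    have "(\<integral>\<^sup>+\<omega>. ennreal (G \<omega>) \<partial>bdlp_kernel m am lam ap t \<eta>) =
        (\<Sum>x\<in>fset \<eta>. ennreal (m t x + (\<Sum>y\<in>fset \<eta> - {x}. am x y)) * ennreal (G (\<eta> |-| {|x|}))) +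
        (\<Sum>x\<in>fset \<eta>. ennreal (lam t x) *
          (\<integral>\<^sup>+y. ennreal (ap x y) * ennreal (G (finsert y \<eta>)) \<partial>lborel))"
      by (rule nn_integral_bdlp_kernel) measurable
    also have "\<dots> =
        (\<Sum>x\<in>fset \<eta>. ennreal ((m t x + (\<Sum>y\<in>fset \<eta> - {x}. am x y)) * G (\<eta> |-| {|x|}))) +
        (\<Sum>x\<in>fset \<eta>. ennreal (lam t x * (\<integral>y. ap x y * G (finsert y \<eta>) \<partial>lborel)))"
      using d G lam birth i
      by (intro arg_cong2[where f = "(+)"] sum.cong) (simp_all add: ennreal_mult)
    also have "\<dots> = ennreal (bdlp_integral m am lam ap t \<eta> G)"
    proof -
      have "0 \<le> (m t x + (\<Sum>y\<in>fset \<eta> - {x}. am x y)) * G (\<eta> |-| {|x|})" for x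
        using d G by (rule mult_nonneg_nonneg)
      moreover have "0 \<le> lam t x * (\<integral>y. ap x y * G (finsert y \<eta>) \<partial>lborel)" for x
        using lam i by (rule mult_nonneg_nonneg)
      ultimately show ?thesis
        unfolding bdlp_integral_def by (simp add: sum_ennreal sum_nonneg ennreal_plus)
    qed
    finally show "(\<integral>\<^sup>+\<omega>. ennreal (G \<omega>) \<partial>bdlp_kernel m am lam ap t \<eta>) =
        ennreal (bdlp_integral m am lam ap t \<eta> G)" .
  qed (use G in auto)
  define P N where "P \<omega> = max 0 (F \<omega>)" and "N \<omega> = max 0 (- F \<omega>)" for \<omega>
  have [measurable]: "P \<in> borel_measurable borel" "N \<in> borel_measurable borel"
    unfolding P_def N_def by measurable
  have F_eq: "F \<omega> = P \<omega> - N \<omega>" for \<omega>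
    by (simp add: P_def N_def max_def)
  have P_int: "integrable lborel (\<lambda>y. ap x y * P (finsert y \<eta>))"
    and N_int: "integrable lborel (\<lambda>y. ap x y * N (finsert y \<eta>))" if "x |\<in>| \<eta>" for x
  proof -
    have "integrable lborel (\<lambda>y. max 0 (ap x y * F (finsert y \<eta>)))"
      "integrable lborel (\<lambda>y. max 0 (- (ap x y * F (finsert y \<eta>))))"
      using int[OF that] by (intro integrable_max integrable_zero integrable_minus; simp)+
    moreover have "max 0 (ap x y * F (finsert y \<eta>)) = ap x y * P (finsert y \<eta>)"
      "max 0 (- (ap x y * F (finsert y \<eta>))) = ap x y * N (finsert y \<eta>)" for y
      using ap[of x y] by (auto simp: P_def N_def max_def mult_le_0_iff zero_le_mult_iff)
    ultimately show "integrable lborel (\<lambda>y. ap x y * P (finsert y \<eta>))"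
      "integrable lborel (\<lambda>y. ap x y * N (finsert y \<eta>))"
      by simp_all
  qed
  have "has_bochner_integral (bdlp_kernel m am lam ap t \<eta>) (\<lambda>\<omega>. P \<omega> - N \<omega>)
      (bdlp_integral m am lam ap t \<eta> P - bdlp_integral m am lam ap t \<eta> N)"
    by (intro has_bochner_integral_diff nonneg_case P_int N_int) (simp_all add: P_def N_def)
  moreover have "bdlp_integral m am lam ap t \<eta> P - bdlp_integral m am lam ap t \<eta> N =
      bdlp_integral m am lam ap t \<eta> F"
  proof -
    have "(\<integral>y. ap x y * F (finsert y \<eta>) \<partial>lborel) =
        (\<integral>y. ap x y * P (finsert y \<eta>) \<partial>lborel) - (\<integral>y. ap x y * N (finsert y \<eta>) \<partial>lborel)"
      if "x |\<in>| \<eta>" for x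
      using P_int[OF that] N_int[OF that]
      by (subst Bochner_Integration.integral_diff[symmetric]) (simp_all add: F_eq right_diff_distrib)
    then show ?thesis
      unfolding bdlp_integral_def
      by (simp add: F_eq right_diff_distrib sum_subtractf)
  qed
  ultimately show ?thesis by (simp add: F_eq[symmetric])
qed

text \<open>
  If \<open>g\<close> labels the points of a moving configuration by those of a fixed \<open>\<eta>\<close>, then all sums run
  over the fixed set \<open>\<eta>\<close>, and the limit can be taken in each summand.
\<close>

lemma bdlp_integral_fimage:
  assumes inj: "inj_on g (fset \<eta>)"
  shows "bdlp_integral m am lam ap t (g |`| \<eta>) F =
    (\<Sum>x\<in>fset \<eta>. (m t (g x) + (\<Sum>y\<in>fset \<eta> - {x}. am (g x) (g y))) * F (g |`| (\<eta> |-| {|x|}))) +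
    (\<Sum>x\<in>fset \<eta>. lam t (g x) * (\<integral>y. ap (g x) y * F (finsert y (g |`| \<eta>)) \<partial>lborel))"
proof -
  have diff: "g ` fset \<eta> - {g x} = g ` (fset \<eta> - {x})" if "x \<in> fset \<eta>" for x
    using inj that by (auto dest: inj_onD)
  have "(g |`| \<eta>) |-| {|g x|} = g |`| (\<eta> |-| {|x|})" if "x \<in> fset \<eta>" for x
    using diff[OF that] by (simp add: fset_inject[symmetric])
  moreover have "(\<Sum>y\<in>g ` fset \<eta> - {g x}. am (g x) y) = (\<Sum>y\<in>fset \<eta> - {x}. am (g x) (g y))"
    if "x \<in> fset \<eta>" for x
    unfolding diff[OF that] by (subst sum.reindex[OF inj_on_subset[OF inj]]) auto
  ultimately show ?thesis
    by (simp add: bdlp_integral_def sum.reindex[OF inj] o_def cong: sum.cong)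
qed

section \<open>The Lyapunov function\<close>

lemma bdlp_V_nonneg: "0 \<le> bdlp_V \<eta>"
  by (simp add: bdlp_V_def)

lemma bdlp_V_mono: "fcard \<eta> \<le> fcard \<zeta> \<Longrightarrow> bdlp_V \<eta> \<le> bdlp_V \<zeta>"
  unfolding bdlp_V_def by (intro add_mono power_mono) simp_all

lemma bdlp_V_finsert_le: "bdlp_V (finsert y \<eta>) \<le> bdlp_V \<eta> + 2 * (real (fcard \<eta>) + 1)"
proof -
  have n: "real (fcard (finsert y \<eta>)) \<le> real (fcard \<eta>) + 1"
    by (simp add: fcard.rep_eq card_insert_if)
  have "bdlp_V (finsert y \<eta>) \<le> (real (fcard \<eta>) + 1) + (real (fcard \<eta>) + 1)\<^sup>2"
    unfolding bdlp_V_def using n by (intro add_mono power_mono) simp_all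
  also have "\<dots> = bdlp_V \<eta> + 2 * (real (fcard \<eta>) + 1)"
    by (simp add: bdlp_V_def power2_eq_square algebra_simps)
  finally show ?thesis .
qed

lemma continuous_on_bdlp_V: "continuous_on UNIV (bdlp_V :: 'a::topological_space fset \<Rightarrow> real)"
  unfolding continuous_on_def
proof
  fix \<eta> :: "'a fset"
  have "\<forall>\<^sub>F \<zeta> in nhds \<eta>. \<zeta> \<in> {\<zeta>. fcard \<zeta> = fcard \<eta>}"
    using open_fset_fcard_eq by (rule eventually_nhds_in_open) simp
  then have "\<forall>\<^sub>F \<zeta> in at \<eta>. bdlp_V \<eta> = bdlp_V \<zeta>"
    by (auto simp: eventually_at_filter bdlp_V_def elim: eventually_mono)
  then show "(bdlp_V \<longlongrightarrow> bdlp_V \<eta>) (at \<eta>)"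
    using tendsto_cong[of "\<lambda>_. bdlp_V \<eta>" bdlp_V] tendsto_const by blast
qed

section \<open>The four conditions\<close>

lemma bounded_image_upper_bound:
  fixes f :: "'b \<Rightarrow> real"
  assumes "bounded (f ` S)"
  shows "\<exists>M\<ge>0. \<forall>z\<in>S. f z \<le> M"
proof -
  obtain M where "0 < M" "\<forall>y\<in>f ` S. norm y \<le> M"
    using assms unfolding bounded_pos by blast
  then show ?thesis
    by (intro exI[of _ M]) (simp add: abs_le_iff)
qed

locale bdlp =
  fixes m lam :: "real \<Rightarrow> 'a::euclidean_space \<Rightarrow> real"
    and am ap :: "'a \<Rightarrow> 'a \<Rightarrow> real"
  assumes m_nonneg: "\<And>t x. t \<ge> 0 \<Longrightarrow> m t x \<ge> 0"
    and m_cont: "continuous_on ({0..} \<times> UNIV) (\<lambda>(t, x). m t x)"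
    and m_bdd: "bounded ((\<lambda>(t, x). m t x) ` ({0..} \<times> UNIV))"
    and lam_nonneg: "\<And>t x. t \<ge> 0 \<Longrightarrow> lam t x \<ge> 0"
    and lam_cont: "continuous_on ({0..} \<times> UNIV) (\<lambda>(t, x). lam t x)"
    and lam_bdd: "bounded ((\<lambda>(t, x). lam t x) ` ({0..} \<times> UNIV))"
    and am_nonneg: "\<And>x y. am x y \<ge> 0"
    and am_cont: "continuous_on UNIV (\<lambda>(x, y). am x y)"
    and am_bdd: "bounded (range (\<lambda>(x, y). am x y))"
    and ap_nonneg: "\<And>x y. ap x y \<ge> 0"
    and ap_cont: "continuous_on UNIV (\<lambda>(x, y). ap x y)"
    and ap_integral: "\<And>x. has_bochner_integral lborel (ap x) 1"
    and ap_dominated: "\<And>\<Lambda>. compact \<Lambda> \<Longrightarrow>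
      \<exists>astar. integrable lebesgue astar \<and> (\<forall>y. astar y \<ge> 0) \<and> (\<forall>x\<in>\<Lambda>. \<forall>y. ap x y \<le> astar y)"
begin

lemma ap_measurable [measurable]: "ap x \<in> borel_measurable borel"
  using ap_integral[of x] by (auto simp: has_bochner_integral_iff dest: borel_measurable_integrable)

lemma nn_integral_ap: "(\<integral>\<^sup>+y. ennreal (ap x y) \<partial>lborel) = 1"
  using has_bochner_integral_nn_integral ap_integral[of x] ap_nonneg
  by (subst nn_integral_eq_integral) (auto simp: has_bochner_integral_iff)

lemma m_bound: "\<exists>M\<ge>0. \<forall>t\<ge>0. \<forall>x. m t x \<le> M"
  using bounded_image_upper_bound[OF m_bdd] by fastforce

lemma lam_bound: "\<exists>M\<ge>0. \<forall>t\<ge>0. \<forall>x. lam t x \<le> M"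
  using bounded_image_upper_bound[OF lam_bdd] by fastforce

lemma am_bound: "\<exists>M\<ge>0. \<forall>x y. am x y \<le> M"
  using bounded_image_upper_bound[OF am_bdd] by fastforce

lemma death_rate_nonneg: "t \<ge> 0 \<Longrightarrow> 0 \<le> m t x + (\<Sum>y\<in>fset \<eta> - {x}. am x y)"
  by (simp add: m_nonneg am_nonneg sum_nonneg)

lemma bdlp_q_eq:
  assumes "t \<ge> 0"
  shows "bdlp_q m am lam ap t \<eta> =
    (\<Sum>x\<in>fset \<eta>. ennreal (m t x + (\<Sum>y\<in>fset \<eta> - {x}. am x y))) +
    (\<Sum>x\<in>fset \<eta>. ennreal (lam t x))"
  by (simp add: bdlp_q_def bdlp_Q_def nn_integral_ap)

text \<open>
  With \<open>n = |\<eta>|\<close>, the total rate is at most \<open>n (M + n A) + n L\<close> for bounds \<open>M\<close>, \<open>A\<close>, \<open>L\<close> of the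
  coefficients: the quadratic part comes from the pairwise competition, which is why \<open>V\<close> contains
  \<open>n\<^sup>2\<close>.
\<close>

lemma exit_rate_le: "\<exists>a>0. \<forall>\<eta>. \<forall>t\<ge>0. bdlp_q m am lam ap t \<eta> \<le> ennreal (a * bdlp_V \<eta>)"
proof -
  obtain M where M: "M \<ge> 0" "\<And>t x. t \<ge> 0 \<Longrightarrow> m t x \<le> M" using m_bound by blast
  obtain L where L: "L \<ge> 0" "\<And>t x. t \<ge> 0 \<Longrightarrow> lam t x \<le> L" using lam_bound by blast
  obtain A where A: "A \<ge> 0" "\<And>x y. am x y \<le> A" using am_bound by blast
  have "bdlp_q m am lam ap t \<eta> \<le> ennreal ((M + A + L + 1) * bdlp_V \<eta>)" if t: "t \<ge> 0" for t \<eta>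
  proof -
    define n where "n = real (fcard \<eta>)"
    have n: "n \<ge> 0" by (simp add: n_def)
    have "(\<Sum>y\<in>fset \<eta> - {x}. am x y) \<le> n * A" for x
    proof -
      have "(\<Sum>y\<in>fset \<eta> - {x}. am x y) \<le> (\<Sum>y\<in>fset \<eta>. am x y)"
        by (intro sum_mono2) (auto simp: am_nonneg)
      also have "\<dots> \<le> n * A"
        unfolding n_def fcard.rep_eq by (intro sum_bounded_above A)
      finally show ?thesis .
    qed
    then have d: "m t x + (\<Sum>y\<in>fset \<eta> - {x}. am x y) \<le> M + n * A" for x
      using M(2)[OF t] by (intro add_mono)
    have "bdlp_q m am lam ap t \<eta> =
        ennreal ((\<Sum>x\<in>fset \<eta>. m t x + (\<Sum>y\<in>fset \<eta> - {x}. am x y)) + (\<Sum>x\<in>fset \<eta>. lam t x))"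
      using t death_rate_nonneg[OF t] lam_nonneg[OF t]
      by (simp only: bdlp_q_eq sum_ennreal ennreal_plus sum_nonneg)
    also have "\<dots> \<le> ennreal (n * (M + n * A) + n * L)"
      unfolding n_def fcard.rep_eq
      by (intro ennreal_leI add_mono sum_bounded_above d[unfolded n_def fcard.rep_eq] L(2) t)
    also have "\<dots> \<le> ennreal ((M + A + L + 1) * bdlp_V \<eta>)"
    proof (rule ennreal_leI)
      have "(M + A + L + 1) * bdlp_V \<eta> - (n * (M + n * A) + n * L) =
          M * n\<^sup>2 + A * n + L * n\<^sup>2 + n + n\<^sup>2"
        by (simp add: bdlp_V_def n_def[symmetric] power2_eq_square algebra_simps)
      also have "\<dots> \<ge> 0"
        using n M(1) A(1) L(1) by simp
      finally show "n * (M + n * A) + n * L \<le> (M + A + L + 1) * bdlp_V \<eta>" by simp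
    qed
    finally show ?thesis .
  qed
  then show ?thesis
    using M(1) A(1) L(1) by (intro exI[of _ "M + A + L + 1"]) auto
qed

text \<open>
  Deaths decrease \<open>V\<close>, however large their rate is, and are absorbed by \<open>q V\<close>. Each birth
  increases \<open>V\<close> by at most \<open>2 (n + 1)\<close>, and the total birth rate is at most \<open>n L\<close>; the excess is
  therefore at most \<open>2 L n (n + 1) = 2 L V(\<eta>)\<close>.
\<close>

lemma drift_inequality:
  "\<exists>c\<ge>0. \<forall>t\<ge>0. \<forall>\<eta>. (\<integral>\<^sup>+\<omega>. ennreal (bdlp_V \<omega>) \<partial>bdlp_kernel m am lam ap t \<eta>) \<le>
    ennreal (c * bdlp_V \<eta>) + bdlp_q m am lam ap t \<eta> * ennreal (bdlp_V \<eta>)"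
proof -
  obtain L where L: "L \<ge> 0" "\<And>t x. t \<ge> 0 \<Longrightarrow> lam t x \<le> L" using lam_bound by blast
  have "(\<integral>\<^sup>+\<omega>. ennreal (bdlp_V \<omega>) \<partial>bdlp_kernel m am lam ap t \<eta>) \<le>
    ennreal (2 * L * bdlp_V \<eta>) + bdlp_q m am lam ap t \<eta> * ennreal (bdlp_V \<eta>)"
    if t: "t \<ge> 0" for t \<eta>
  proof -
    define n where "n = real (fcard \<eta>)"
    define d where "d x = ennreal (m t x + (\<Sum>y\<in>fset \<eta> - {x}. am x y))" for x
    have n: "n \<ge> 0" by (simp add: n_def)
    have V: "ennreal (bdlp_V (finsert y \<eta>)) \<le> ennreal (bdlp_V \<eta>) + ennreal (2 * (n + 1))" for y
    proof -
      have "ennreal (bdlp_V (finsert y \<eta>)) \<le> ennreal (bdlp_V \<eta> + 2 * (n + 1))"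
        unfolding n_def by (intro ennreal_leI bdlp_V_finsert_le)
      also have "\<dots> = ennreal (bdlp_V \<eta>) + ennreal (2 * (n + 1))"
        using n bdlp_V_nonneg by (intro ennreal_plus) simp_all
      finally show ?thesis .
    qed
    have birth: "(\<integral>\<^sup>+y. ennreal (ap x y) * ennreal (bdlp_V (finsert y \<eta>)) \<partial>lborel) \<le>
        ennreal (bdlp_V \<eta>) + ennreal (2 * (n + 1))" for x
    proof -
      have "(\<integral>\<^sup>+y. ennreal (ap x y) * ennreal (bdlp_V (finsert y \<eta>)) \<partial>lborel) \<le>
          (\<integral>\<^sup>+y. ennreal (ap x y) * (ennreal (bdlp_V \<eta>) + ennreal (2 * (n + 1))) \<partial>lborel)"
        by (intro nn_integral_mono mult_left_mono V) simp
      also have "\<dots> = ennreal (bdlp_V \<eta>) + ennreal (2 * (n + 1))"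
        by (subst nn_integral_multc) (simp_all add: nn_integral_ap)
      finally show ?thesis .
    qed
    have "(\<lambda>\<omega>. ennreal (bdlp_V \<omega>)) \<in> borel_measurable (borel :: 'a fset measure)"
      using borel_measurable_continuous_onI[OF continuous_on_bdlp_V] by measurable
    then have "(\<integral>\<^sup>+\<omega>. ennreal (bdlp_V \<omega>) \<partial>bdlp_kernel m am lam ap t \<eta>) =
        (\<Sum>x\<in>fset \<eta>. d x * ennreal (bdlp_V (\<eta> |-| {|x|}))) +
        (\<Sum>x\<in>fset \<eta>. ennreal (lam t x) *
          (\<integral>\<^sup>+y. ennreal (ap x y) * ennreal (bdlp_V (finsert y \<eta>)) \<partial>lborel))"
      unfolding d_def by (rule nn_integral_bdlp_kernel[OF ap_measurable])
    also have "\<dots> \<le> (\<Sum>x\<in>fset \<eta>. d x * ennreal (bdlp_V \<eta>)) +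
        (\<Sum>x\<in>fset \<eta>. ennreal (lam t x) * (ennreal (bdlp_V \<eta>) + ennreal (2 * (n + 1))))"
    proof (intro add_mono sum_mono mult_left_mono birth ennreal_leI bdlp_V_mono)
      show "fcard (\<eta> |-| {|x|}) \<le> fcard \<eta>" for x
        by (simp add: fcard.rep_eq card_mono)
    qed simp_all
    also have "\<dots> = bdlp_q m am lam ap t \<eta> * ennreal (bdlp_V \<eta>) +
        (\<Sum>x\<in>fset \<eta>. ennreal (lam t x)) * ennreal (2 * (n + 1))"
      unfolding bdlp_q_eq[OF t] d_def[symmetric]
      by (simp only: distrib_left distrib_right sum_distrib_right sum.distrib add.assoc)
    also have "(\<Sum>x\<in>fset \<eta>. ennreal (lam t x)) * ennreal (2 * (n + 1)) \<le> ennreal (2 * L * bdlp_V \<eta>)"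
    proof -
      have "(\<Sum>x\<in>fset \<eta>. ennreal (lam t x)) * ennreal (2 * (n + 1)) =
          ennreal ((\<Sum>x\<in>fset \<eta>. lam t x) * (2 * (n + 1)))"
        using lam_nonneg[OF t] n by (simp add: sum_ennreal ennreal_mult sum_nonneg)
      also have "\<dots> \<le> ennreal (n * L * (2 * (n + 1)))"
        unfolding n_def fcard.rep_eq
        by (intro ennreal_leI mult_right_mono sum_bounded_above L(2) t) simp
      also have "n * L * (2 * (n + 1)) = 2 * L * bdlp_V \<eta>"
        by (simp add: bdlp_V_def n_def power2_eq_square algebra_simps)
      finally show ?thesis .
    qed
    finally show ?thesis by (simp add: add.commute)
  qed
  then show ?thesis
    using L(1) by (intro exI[of _ "2 * L"]) auto
qed

text \<open>
  Adding one point to configurations of bounded cardinality keeps \<open>V\<close> bounded, so \<open>F\<close> is bounded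
  along all births from such configurations.
\<close>

lemma growth_bound:
  assumes "bdd_above (range (\<lambda>\<eta>. \<bar>F \<eta>\<bar> / (1 + bdlp_V \<eta>)))"
  obtains C where "C \<ge> 0" "\<And>y \<eta>. fcard \<eta> \<le> n \<Longrightarrow> \<bar>F (finsert y \<eta>)\<bar> \<le> C"
proof -
  obtain K where K: "\<And>\<eta>. \<bar>F \<eta>\<bar> / (1 + bdlp_V \<eta>) \<le> K"
    using assms by (auto simp: bdd_above_def)
  have V1: "1 + bdlp_V \<eta> > 0" for \<eta> :: "'b fset"
    using bdlp_V_nonneg[of \<eta>] by simp
  have K0: "K \<ge> 0"
    by (rule order_trans[OF _ K[of undefined]]) (simp add: bdlp_V_nonneg)
  have le: "\<bar>F \<eta>\<bar> \<le> K * (1 + bdlp_V \<eta>)" for \<eta>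
    using K[of \<eta>] V1[of \<eta>] by (simp add: pos_divide_le_eq)
  define v where "v = real (n + 1) + (real (n + 1))\<^sup>2"
  have "\<bar>F (finsert y \<eta>)\<bar> \<le> K * (1 + v)" if "fcard \<eta> \<le> n" for y \<eta>
  proof -
    have "fcard (finsert y \<eta>) \<le> n + 1"
      using that by (simp add: fcard.rep_eq card_insert_if)
    then have "bdlp_V (finsert y \<eta>) \<le> v"
      unfolding bdlp_V_def v_def by (intro add_mono power_mono) simp_all
    then show ?thesis
      using le[of "finsert y \<eta>"] K0 by (smt (verit) mult_left_mono)
  qed
  then show thesis
    using that[of "K * (1 + v)"] K0 by (simp add: v_def)
qed

lemma integrable_birth:
  fixes F :: "'a fset \<Rightarrow> real"
  assumes F [measurable]: "F \<in> borel_measurable borel"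
    and growth: "bdd_above (range (\<lambda>\<eta>. \<bar>F \<eta>\<bar> / (1 + bdlp_V \<eta>)))"
  shows "integrable lborel (\<lambda>y. ap x y * F (finsert y \<eta>))"
proof -
  obtain C where C: "C \<ge> 0" "\<And>y \<zeta>. fcard \<zeta> \<le> fcard \<eta> \<Longrightarrow> \<bar>F (finsert y \<zeta>)\<bar> \<le> C"
    by (rule growth_bound[OF growth, of "fcard \<eta>"]) blast
  show ?thesis
  proof (rule Bochner_Integration.integrable_bound)
    show "integrable lborel (\<lambda>y. ap x y * C)"
      using ap_integral[of x] by (auto simp: has_bochner_integral_iff)
    show "AE y in lborel. norm (ap x y * F (finsert y \<eta>)) \<le> norm (ap x y * C)"
      using C ap_nonneg by (auto simp: abs_mult intro!: mult_left_mono)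
  qed measurable
qed

text \<open>
  Dominated convergence: the parents \<open>g k x\<close> together with their limit \<open>x\<close> form a compact set,
  which provides a common integrable majorant of the dispersal kernels, and \<open>F\<close> is bounded along the
  births. Pointwise convergence can fail where the new point falls into \<open>\<eta>\<close>, which is a null set.
  The majorant is only Lebesgue measurable, so the limit is taken with respect to the completed
  measure.
\<close>

lemma tendsto_birth:
  fixes F :: "'a fset \<Rightarrow> real"
  assumes F: "continuous_on UNIV F"
    and growth: "bdd_above (range (\<lambda>\<eta>. \<bar>F \<eta>\<bar> / (1 + bdlp_V \<eta>)))"
    and g: "\<And>x. x |\<in>| \<eta> \<Longrightarrow> (\<lambda>k. g k x) \<longlonglongrightarrow> x"
    and x: "x |\<in>| \<eta>"
  shows "(\<lambda>k. \<integral>y. ap (g k x) y * F (finsert y (g k |`| \<eta>)) \<partial>lborel) \<longlonglongrightarrow>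
    (\<integral>y. ap x y * F (finsert y \<eta>) \<partial>lborel)"
proof -
  have [measurable]: "F \<in> borel_measurable borel"
    using F by (rule borel_measurable_continuous_onI)
  obtain C where C: "C \<ge> 0" "\<And>y \<zeta>. fcard \<zeta> \<le> fcard \<eta> \<Longrightarrow> \<bar>F (finsert y \<zeta>)\<bar> \<le> C"
    by (rule growth_bound[OF growth, of "fcard \<eta>"]) blast
  have "compact (insert x (range (\<lambda>k. g k x)))"
    using g[OF x] by (rule compact_sequence_with_limit)
  from ap_dominated[OF this] obtain astar where astar: "integrable lebesgue astar"
    and "\<forall>y. astar y \<ge> 0" and "\<forall>z\<in>insert x (range (\<lambda>k. g k x)). \<forall>y. ap z y \<le> astar y"
    by blast
  then have astar_ge: "astar y \<ge> 0" "ap (g k x) y \<le> astar y" for k y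
    by simp_all
  have meas: "(\<lambda>y. ap z y * F (finsert y \<zeta>)) \<in> borel_measurable lborel" for z \<zeta>
    by measurable
  have "(\<lambda>k. \<integral>y. ap (g k x) y * F (finsert y (g k |`| \<eta>)) \<partial>lebesgue) \<longlonglongrightarrow>
    (\<integral>y. ap x y * F (finsert y \<eta>) \<partial>lebesgue)"
  proof (rule integral_dominated_convergence[where w = "\<lambda>y. astar y * C"])
    have "AE y in lebesgue. y \<notin> fset \<eta>"
      by (intro AE_completion AE_not_in finite_imp_null_set_lborel) simp
    then show "AE y in lebesgue. (\<lambda>k. ap (g k x) y * F (finsert y (g k |`| \<eta>))) \<longlonglongrightarrow>
        ap x y * F (finsert y \<eta>)"
    proof eventually_elim
      fix y assume y: "y \<notin> fset \<eta>"
      \<comment> \<open>The new point \<open>y\<close> is labelled by itself, so that \<open>finsert y (g k |`| \<eta>)\<close> is again the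
        image of a fixed configuration.\<close>
      have "(\<lambda>k. ((g k)(y := y)) z) \<longlonglongrightarrow> z" if "z |\<in>| finsert y \<eta>" for z
        using that g by (cases "z = y") auto
      then have "(\<lambda>k. (g k)(y := y) |`| finsert y \<eta>) \<longlonglongrightarrow> finsert y \<eta>"
        by (rule tendsto_fimage)
      moreover have "(g k)(y := y) |`| finsert y \<eta> = finsert y (g k |`| \<eta>)" for k
        using y by (auto simp: fset_inject[symmetric])
      ultimately have "(\<lambda>k. finsert y (g k |`| \<eta>)) \<longlonglongrightarrow> finsert y \<eta>"
        by simp
      then have "(\<lambda>k. F (finsert y (g k |`| \<eta>))) \<longlonglongrightarrow> F (finsert y \<eta>)"
        using continuous_on_tendsto_compose[OF F] by simp
      moreover have "(\<lambda>k. (g k x, y)) \<longlonglongrightarrow> (x, y)"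
        using g[OF x] by (intro tendsto_Pair) auto
      then have "(\<lambda>k. ap (g k x) y) \<longlonglongrightarrow> ap x y"
        using continuous_on_tendsto_compose[OF ap_cont] by fastforce
      ultimately show "(\<lambda>k. ap (g k x) y * F (finsert y (g k |`| \<eta>))) \<longlonglongrightarrow>
          ap x y * F (finsert y \<eta>)"
        by (intro tendsto_mult)
    qed
    have "fcard (g k |`| \<eta>) \<le> fcard \<eta>" for k
      by (simp add: fcard.rep_eq card_image_le)
    then show "AE y in lebesgue. norm (ap (g k x) y * F (finsert y (g k |`| \<eta>))) \<le> astar y * C" for k
      using C ap_nonneg astar_ge by (auto simp: abs_mult intro!: mult_mono)
    show "integrable lebesgue (\<lambda>y. astar y * C)"
      using astar by simp
  qed (intro measurable_completion meas)+
  then show ?thesis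
    by (simp add: integral_completion[OF meas])
qed

text \<open>
  Along a sequence \<open>(s k, \<zeta> k)\<close> converging to \<open>(t, \<eta>)\<close>, nearest points label \<open>\<zeta> k\<close> by \<open>\<eta>\<close>. The
  integral becomes a sum over \<open>\<eta>\<close> by \<open>bdlp_integral_fimage\<close>, and each summand converges.
\<close>

lemma continuous_integral_bdlp_kernel:
  fixes F :: "'a fset \<Rightarrow> real"
  assumes F: "continuous_on UNIV F"
    and growth: "bdd_above (range (\<lambda>\<eta>. \<bar>F \<eta>\<bar> / (1 + bdlp_V \<eta>)))"
  shows "\<And>t \<eta>. t \<ge> 0 \<Longrightarrow> integrable (bdlp_kernel m am lam ap t \<eta>) F"
    and "continuous_on ({0..} \<times> UNIV) (\<lambda>(t, \<eta>). \<integral>\<omega>. F \<omega> \<partial>bdlp_kernel m am lam ap t \<eta>)"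
proof -
  have F_meas: "F \<in> borel_measurable borel"
    using F by (rule borel_measurable_continuous_onI)
  have int: "has_bochner_integral (bdlp_kernel m am lam ap t \<eta>) F (bdlp_integral m am lam ap t \<eta> F)"
    if "t \<ge> 0" for t \<eta>
    using that by (intro has_bochner_integral_bdlp_kernel F_meas integrable_birth growth ap_measurable
        m_nonneg am_nonneg lam_nonneg ap_nonneg)
  then show "integrable (bdlp_kernel m am lam ap t \<eta>) F" if "t \<ge> 0" for t \<eta>
    using that by (auto simp: has_bochner_integral_iff)
  have lim: "(\<lambda>k. bdlp_integral m am lam ap (s k) (\<zeta> k) F) \<longlonglongrightarrow> bdlp_integral m am lam ap t \<eta> F"
    if s: "\<And>k. s k \<ge> 0" "s \<longlonglongrightarrow> t" and \<zeta>: "\<zeta> \<longlonglongrightarrow> \<eta>" for s t \<zeta> \<eta>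
  proof -
    define g where "g k = nearest (\<zeta> k)" for k
    have t: "t \<ge> 0"
      using s by (auto intro: LIMSEQ_le_const)
    have g: "(\<lambda>k. g k x) \<longlonglongrightarrow> x" if "x |\<in>| \<eta>" for x
      unfolding g_def using tendsto_nearest[OF that] \<zeta> by (rule filterlim_compose)
    have "\<forall>\<^sub>F k in sequentially. bij_betw (g k) (fset \<eta>) (fset (\<zeta> k))"
      unfolding g_def using eventually_bij_betw_nearest \<zeta> by (rule eventually_compose_filterlim)
    then have "\<forall>\<^sub>F k in sequentially.
      (\<Sum>x\<in>fset \<eta>. (m (s k) (g k x) + (\<Sum>y\<in>fset \<eta> - {x}. am (g k x) (g k y))) *
        F (g k |`| (\<eta> |-| {|x|}))) +
      (\<Sum>x\<in>fset \<eta>. lam (s k) (g k x) *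
        (\<integral>y. ap (g k x) y * F (finsert y (g k |`| \<eta>)) \<partial>lborel)) =
      bdlp_integral m am lam ap (s k) (\<zeta> k) F"
    proof eventually_elim
      case (elim k)
      then have "inj_on (g k) (fset \<eta>)" "\<zeta> k = g k |`| \<eta>"
        by (auto simp: bij_betw_def fset_inject[symmetric])
      then show ?case by (simp only: bdlp_integral_fimage)
    qed
    moreover have "(\<lambda>k.
      (\<Sum>x\<in>fset \<eta>. (m (s k) (g k x) + (\<Sum>y\<in>fset \<eta> - {x}. am (g k x) (g k y))) *
        F (g k |`| (\<eta> |-| {|x|}))) +
      (\<Sum>x\<in>fset \<eta>. lam (s k) (g k x) *
        (\<integral>y. ap (g k x) y * F (finsert y (g k |`| \<eta>)) \<partial>lborel))) \<longlonglongrightarrow>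
      bdlp_integral m am lam ap t \<eta> F"
      unfolding bdlp_integral_def
    proof (intro tendsto_add tendsto_sum tendsto_mult tendsto_birth F growth g)
      fix x assume x: "x \<in> fset \<eta>"
      have sg: "(\<lambda>k. (s k, g k x)) \<longlonglongrightarrow> (t, x)"
        using s(2) g[OF x] by (rule tendsto_Pair)
      show "(\<lambda>k. m (s k) (g k x)) \<longlonglongrightarrow> m t x"
        using continuous_on_tendsto_compose[OF m_cont sg] s(1) t by simp
      show "(\<lambda>k. lam (s k) (g k x)) \<longlonglongrightarrow> lam t x"
        using continuous_on_tendsto_compose[OF lam_cont sg] s(1) t by simp
      show "(\<lambda>k. F (g k |`| (\<eta> |-| {|x|}))) \<longlonglongrightarrow> F (\<eta> |-| {|x|})"
        by (rule continuous_on_tendsto_compose[OF F tendsto_fimage]) (use g in auto)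
      fix y assume y: "y \<in> fset \<eta> - {x}"
      have "(\<lambda>k. (g k x, g k y)) \<longlonglongrightarrow> (x, y)"
        using g[OF x] g y by (intro tendsto_Pair) auto
      then show "(\<lambda>k. am (g k x) (g k y)) \<longlonglongrightarrow> am x y"
        using continuous_on_tendsto_compose[OF am_cont] by fastforce
    qed
    ultimately show ?thesis
      by (rule Lim_transform_eventually[rotated])
  qed
  show "continuous_on ({0..} \<times> UNIV) (\<lambda>(t, \<eta>). \<integral>\<omega>. F \<omega> \<partial>bdlp_kernel m am lam ap t \<eta>)"
    unfolding continuous_on_def
  proof
    fix p :: "real \<times> 'a fset" assume "p \<in> {0..} \<times> UNIV"
    then obtain t \<eta> where p: "p = (t, \<eta>)" "t \<ge> 0" by auto
    show "((\<lambda>(t, \<eta>). \<integral>\<omega>. F \<omega> \<partial>bdlp_kernel m am lam ap t \<eta>) \<longlongrightarrow>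
        (case p of (t, \<eta>) \<Rightarrow> \<integral>\<omega>. F \<omega> \<partial>bdlp_kernel m am lam ap t \<eta>)) (at p within {0..} \<times> UNIV)"
      unfolding tendsto_at_iff_sequentially
    proof (intro allI impI)
      fix X :: "nat \<Rightarrow> real \<times> 'a fset"
      assume X: "\<forall>i. X i \<in> {0..} \<times> UNIV - {p}" "X \<longlonglongrightarrow> p"
      have nonneg: "fst (X k) \<ge> 0" for k
        using X(1)[rule_format, of k] by auto
      have "(\<lambda>k. bdlp_integral m am lam ap (fst (X k)) (snd (X k)) F) \<longlonglongrightarrow> bdlp_integral m am lam ap t \<eta> F"
        using nonneg tendsto_fst[OF X(2)] tendsto_snd[OF X(2)] p by (intro lim) simp_all
      then show "((\<lambda>(t, \<eta>). \<integral>\<omega>. F \<omega> \<partial>bdlp_kernel m am lam ap t \<eta>) \<circ> X) \<longlonglongrightarrow>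
          (case p of (t, \<eta>) \<Rightarrow> \<integral>\<omega>. F \<omega> \<partial>bdlp_kernel m am lam ap t \<eta>)"
        using p nonneg
        by (simp add: o_def case_prod_beta has_bochner_integral_integral_eq[OF int])
    qed
  qed
qed

text \<open>
  The integral of the majorant over the complement of a large ball is small, uniformly over the
  parents in \<open>cball 0 R0\<close>.
\<close>

lemma tail_small:
  assumes "e > 0"
  obtains R where "R \<ge> R0"
    "\<And>x. x \<in> cball 0 R0 \<Longrightarrow>
      (\<integral>\<^sup>+y. ennreal (ap x y) * indicator (- cball 0 R) y \<partial>lborel) \<le> ennreal e"
proof -
  obtain astar where astar: "integrable lebesgue astar" "\<And>y. astar y \<ge> 0"
    "\<And>x y. x \<in> cball 0 R0 \<Longrightarrow> ap x y \<le> astar y"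
    using ap_dominated[OF compact_cball] by metis
  define T where "T k y = astar y * indicator (- cball 0 (real k)) y" for k :: nat and y
  have T_int: "integrable lebesgue (T k)" for k
    unfolding T_def using astar(1) by (intro integrable_real_mult_indicator) simp_all
  have "(\<lambda>k. \<integral>y. T k y \<partial>lebesgue) \<longlonglongrightarrow> (\<integral>y. 0 \<partial>(lebesgue :: 'a measure))"
  proof (rule integral_dominated_convergence[OF _ _ astar(1)])
    show "T k \<in> borel_measurable lebesgue" for k
      using T_int by (rule borel_measurable_integrable)
    show "AE y in lebesgue. norm (T k y) \<le> astar y" for k
      using astar(2) by (auto simp: T_def indicator_def)
    show "AE y in lebesgue. (\<lambda>k. T k y) \<longlonglongrightarrow> 0"
    proof (rule AE_I2)
      fix y :: 'a
      have "\<forall>\<^sub>F k in sequentially. T k y = 0"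
        using eventually_ge_at_top[of "nat \<lceil>norm y\<rceil>"]
        by eventually_elim (auto simp: T_def indicator_def nat_le_iff ceiling_le_iff)
      then show "(\<lambda>k. T k y) \<longlonglongrightarrow> 0"
        by (rule tendsto_eventually)
    qed
  qed simp
  then have "\<forall>\<^sub>F k in sequentially. (\<integral>y. T k y \<partial>lebesgue) < e"
    using assms by (intro order_tendstoD(2)) simp_all
  then have "\<forall>\<^sub>F k in sequentially. (\<integral>y. T k y \<partial>lebesgue) < e \<and> R0 \<le> real k"
    using eventually_ge_at_top[of "nat \<lceil>R0\<rceil>"]
    by eventually_elim linarith
  then obtain k where k: "(\<integral>y. T k y \<partial>lebesgue) < e" "R0 \<le> real k"
    using eventually_happens'[OF sequentially_bot] by blast
  have "(\<integral>\<^sup>+y. ennreal (ap x y) * indicator (- cball 0 (real k)) y \<partial>lborel) \<le> ennreal e"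
    if x: "x \<in> cball 0 R0" for x
  proof -
    have "(\<integral>\<^sup>+y. ennreal (ap x y) * indicator (- cball 0 (real k)) y \<partial>lborel) =
        (\<integral>\<^sup>+y. ennreal (ap x y) * indicator (- cball 0 (real k)) y \<partial>lebesgue)"
      by (simp add: nn_integral_completion)
    also have "\<dots> \<le> (\<integral>\<^sup>+y. ennreal (T k y) \<partial>lebesgue)"
      using astar(3)[OF x] by (intro nn_integral_mono) (auto simp: T_def indicator_def intro!: ennreal_leI)
    also have "\<dots> = ennreal (\<integral>y. T k y \<partial>lebesgue)"
      using astar(2) by (intro nn_integral_eq_integral T_int) (simp add: T_def)
    also have "\<dots> \<le> ennreal e"
      using k(1) by (intro ennreal_leI) simp
    finally show ?thesis .
  qed
  with k(2) show thesis by (rule that)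
qed

text \<open>
  A compact \<open>B\<close> consists of \<open>d\<close>-separated configurations of at most \<open>N\<close> points in a ball. A death
  keeps these properties. A birth destroys them only if the new point lies outside a large ball of
  radius \<open>R\<close>, which is improbable by \<open>tail_small\<close>, or within distance \<open>h\<close> of one of the at most \<open>N\<close>
  old points. In the latter case the density \<open>ap\<close> is at most a constant \<open>C\<close>, because parent and new
  point both lie in compact sets, and the probability is at most \<open>N C |ball z h|\<close>.
\<close>

lemma compact_containment:
  fixes B :: "'a fset set"
  assumes e: "e > 0" and T: "T > 0" and B: "compact B"
  shows "\<exists>A. compact A \<and>
    (\<forall>\<eta>\<in>B. (\<integral>\<^sup>+r\<in>{0..T}. bdlp_Q m am lam ap r \<eta> (- A) \<partial>lborel) < ennreal e)"
proof -
  obtain L where L: "L \<ge> 0" "\<And>t x. t \<ge> 0 \<Longrightarrow> lam t x \<le> L" using lam_bound by blast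
  obtain N R0 d where d: "d > 0" and B_sub: "B \<subseteq> separated_in (cball 0 R0) N d"
    using compact_subset_separated_in[OF B] by metis
  \<comment> \<open>The parameters \<open>R\<close> and \<open>h\<close> make each of the two bad births of each parent have
    probability at most \<open>e1\<close>; the integral is then at most \<open>T N L (2 e1) \<le> e / 2\<close>. The summand
    \<open>1\<close> keeps the denominator positive when \<open>B\<close> or the birth rate is trivial.\<close>
  define W where "W = T * (real N * L) + 1"
  have W: "W > 0" "T * (real N * L) \<le> W"
    using T L(1) by (auto simp: W_def intro!: add_nonneg_pos)
  define e1 where "e1 = e / (4 * W)"
  have e1: "e1 > 0" using e W by (simp add: e1_def)
  obtain R where R: "R \<ge> R0" "\<And>x. x \<in> cball 0 R0 \<Longrightarrow>
      (\<integral>\<^sup>+y. ennreal (ap x y) * indicator (- cball 0 R) y \<partial>lborel) \<le> ennreal e1"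
    using tail_small[OF e1] by metis
  have "compact ((\<lambda>(x, y). ap x y) ` (cball 0 R0 \<times> cball 0 R))"
    by (intro compact_continuous_image continuous_on_subset[OF ap_cont] compact_Times) auto
  then have "bounded ((\<lambda>(x, y). ap x y) ` (cball 0 R0 \<times> cball 0 R))"
    by (rule compact_imp_bounded)
  then obtain C where "C > 0"
    and C_bound: "\<forall>z\<in>(\<lambda>(x, y). ap x y) ` (cball 0 R0 \<times> cball 0 R). norm z \<le> C"
    unfolding bounded_pos by blast
  have C: "ap x y \<le> C" if "x \<in> cball 0 R0" "y \<in> cball 0 R" for x y
  proof -
    have "norm (ap x y) \<le> C"
      using that by (intro C_bound[rule_format]) force
    then show ?thesis by simp
  qed
  define u where "u = unit_ball_vol (real DIM('a))"
  have u: "u \<ge> 0" by (simp add: u_def)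
  \<comment> \<open>The volume of \<open>ball z h\<close> is \<open>u h ^ DIM('a) \<le> u h\<close> as \<open>h \<le> 1\<close>.\<close>
  define h where "h = min d (min 1 (e1 / (real N * C * u + 1)))"
  have "real N * C * u \<ge> 0" using \<open>C > 0\<close> u by simp
  then have h: "h > 0" "h \<le> d" "h \<le> 1" "real N * C * u * h \<le> e1"
  proof -
    assume *: "real N * C * u \<ge> 0"
    show "h > 0" using d e1 * by (simp add: h_def add_nonneg_pos)
    have "real N * C * u * h \<le> (real N * C * u + 1) * (e1 / (real N * C * u + 1))"
      using * \<open>h > 0\<close> by (intro mult_mono) (simp_all add: h_def)
    also have "\<dots> = e1" using * by simp
    finally show "real N * C * u * h \<le> e1" .
  qed (simp_all add: h_def)
  define A where "A = separated_in (cball (0 :: 'a) R) (N + 1) h"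
  have "compact A"
    unfolding A_def using h(1) by (intro compact_separated_in compact_cball)
  moreover have "(\<integral>\<^sup>+r\<in>{0..T}. bdlp_Q m am lam ap r \<eta> (- A) \<partial>lborel) < ennreal e"
    if "\<eta> \<in> B" for \<eta>
  proof -
    have \<eta>: "fcard \<eta> \<le> N" "fset \<eta> \<subseteq> cball 0 R0"
      "\<And>x y. x \<in> fset \<eta> \<Longrightarrow> y \<in> fset \<eta> \<Longrightarrow> x \<noteq> y \<Longrightarrow> d \<le> dist x y"
      using that B_sub by (auto simp: separated_in_def)
    have \<eta>R: "fset \<eta> \<subseteq> cball 0 R"
      using \<eta>(2) R(1) by auto
    have death: "\<eta> |-| {|x|} \<in> A" for x
    proof -
      have "fcard (\<eta> |-| {|x|}) \<le> fcard \<eta>"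
        by (simp add: fcard.rep_eq card_mono)
      then show ?thesis
        using \<eta>(1) \<eta>R order_trans[OF h(2) \<eta>(3)] unfolding A_def separated_in_def by auto
    qed
    have birth: "finsert y \<eta> \<in> A" if y: "y \<in> cball 0 R" "\<And>z. z \<in> fset \<eta> \<Longrightarrow> y \<notin> ball z h" for y
    proof -
      have "fcard (finsert y \<eta>) \<le> N + 1"
        using \<eta>(1) by (simp add: fcard.rep_eq card_insert_if)
      moreover have "h \<le> dist z y" "h \<le> dist y z" if "z \<in> fset \<eta>" for z
        using y(2)[OF that] by (simp_all add: dist_commute)
      ultimately show ?thesis
        using y(1) \<eta>R order_trans[OF h(2) \<eta>(3)] unfolding A_def separated_in_def by auto
    qed
    have jump: "(\<integral>\<^sup>+y. ennreal (ap x y) * indicator (- A) (finsert y \<eta>) \<partial>lborel) \<le> ennreal (2 * e1)"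
      if x: "x \<in> fset \<eta>" for x
    proof -
      have "(\<integral>\<^sup>+y. ennreal (ap x y) * indicator (- A) (finsert y \<eta>) \<partial>lborel) \<le>
          (\<integral>\<^sup>+y. ennreal (ap x y) * indicator (- cball 0 R) y +
            (\<Sum>z\<in>fset \<eta>. ennreal C * indicator (ball z h) y) \<partial>lborel)"
      proof (rule nn_integral_mono)
        fix y :: 'a
        consider "y \<notin> cball 0 R" | "finsert y \<eta> \<in> A"
          | z where "y \<in> cball 0 R" "z \<in> fset \<eta>" "y \<in> ball z h"
          using birth by blast
        then show "ennreal (ap x y) * indicator (- A) (finsert y \<eta>) \<le>
            ennreal (ap x y) * indicator (- cball 0 R) y +
            (\<Sum>z\<in>fset \<eta>. ennreal C * indicator (ball z h) y)"
        proof cases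
          case 1
          then show ?thesis by (auto simp: indicator_def intro: add_increasing2)
        next
          case 2
          then show ?thesis by simp
        next
          case 3
          have "ennreal (ap x y) * indicator (- A) (finsert y \<eta>) \<le> ennreal C"
            using C[of x y] 3(1) x \<eta>(2) by (auto simp: indicator_def intro!: ennreal_leI)
          also have "\<dots> = ennreal C * indicator (ball z h) y"
            using 3(3) by simp
          also have "\<dots> \<le> (\<Sum>z\<in>fset \<eta>. ennreal C * indicator (ball z h) y)"
            using 3(2) by (intro member_le_sum) auto
          finally show ?thesis by (rule add_increasing[rotated]) simp
        qed
      qed
      also have "\<dots> = (\<integral>\<^sup>+y. ennreal (ap x y) * indicator (- cball 0 R) y \<partial>lborel) +
          (\<Sum>z\<in>fset \<eta>. ennreal C * emeasure lborel (ball z h))"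
      proof -
        have [measurable]: "ball z h \<in> sets borel" for z :: 'a
          by simp
        have "(\<integral>\<^sup>+y. (\<Sum>z\<in>fset \<eta>. ennreal C * indicator (ball z h) y) \<partial>lborel) =
            (\<Sum>z\<in>fset \<eta>. \<integral>\<^sup>+y. ennreal C * indicator (ball z h) y \<partial>lborel)"
          by (rule nn_integral_sum) measurable
        also have "\<dots> = (\<Sum>z\<in>fset \<eta>. ennreal C * emeasure lborel (ball z h))"
          by (intro sum.cong refl nn_integral_cmult_indicator) simp
        finally show ?thesis
          by (subst nn_integral_add) measurable
      qed
      also have "\<dots> \<le> ennreal e1 + (\<Sum>z\<in>fset \<eta>. ennreal (C * (u * h)))"
      proof (intro add_mono R(2) sum_mono)
        show "x \<in> cball 0 R0" using x \<eta>(2) by blast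
        fix z :: 'a
        have "h ^ DIM('a) \<le> h ^ 1"
          using h by (intro power_decreasing) (simp_all add: Suc_leI)
        then have "C * (u * h ^ DIM('a)) \<le> C * (u * h)"
          using \<open>C > 0\<close> u by (intro mult_left_mono) simp_all
        then show "ennreal C * emeasure lborel (ball z h) \<le> ennreal (C * (u * h))"
          using h(1) \<open>C > 0\<close> u
          by (simp add: emeasure_ball u_def[symmetric] ennreal_mult[symmetric] ennreal_leI)
      qed
      also have "\<dots> = ennreal (e1 + real (fcard \<eta>) * (C * (u * h)))"
        using e1 \<open>C > 0\<close> u h(1)
        by (simp add: fcard.rep_eq ennreal_plus ennreal_mult ennreal_of_nat_eq_real_of_nat)
      also have "\<dots> \<le> ennreal (2 * e1)"
      proof (rule ennreal_leI)
        have "real (fcard \<eta>) * (C * (u * h)) \<le> real N * (C * (u * h))"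
          using \<eta>(1) \<open>C > 0\<close> u h(1) by (intro mult_right_mono) simp_all
        also have "\<dots> \<le> e1" using h(4) by (simp add: mult.assoc)
        finally show "e1 + real (fcard \<eta>) * (C * (u * h)) \<le> 2 * e1" by simp
      qed
      finally show ?thesis .
    qed
    have Q: "bdlp_Q m am lam ap r \<eta> (- A) \<le> ennreal (real N * (L * (2 * e1)))" if r: "r \<ge> 0" for r
    proof -
      have "bdlp_Q m am lam ap r \<eta> (- A) = (\<Sum>x\<in>fset \<eta>. ennreal (lam r x) *
          (\<integral>\<^sup>+y. ennreal (ap x y) * indicator (- A) (finsert y \<eta>) \<partial>lborel))"
        unfolding bdlp_Q_def using death by simp
      also have "\<dots> \<le> (\<Sum>x\<in>fset \<eta>. ennreal L * ennreal (2 * e1))"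
        using L(2)[OF r] by (intro sum_mono mult_mono jump ennreal_leI) simp_all
      also have "\<dots> = ennreal (real (fcard \<eta>) * (L * (2 * e1)))"
        using L(1) e1 by (simp add: fcard.rep_eq ennreal_mult ennreal_of_nat_eq_real_of_nat)
      also have "\<dots> \<le> ennreal (real N * (L * (2 * e1)))"
        using \<eta>(1) L(1) e1 by (intro ennreal_leI mult_right_mono) simp_all
      finally show ?thesis .
    qed
    have "(\<integral>\<^sup>+r\<in>{0..T}. bdlp_Q m am lam ap r \<eta> (- A) \<partial>lborel) \<le>
        (\<integral>\<^sup>+r. ennreal (real N * (L * (2 * e1))) * indicator {0..T} r \<partial>lborel)"
      using Q by (intro nn_integral_mono) (auto simp: indicator_def)
    also have "\<dots> = ennreal (real N * (L * (2 * e1)) * T)"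
      using T L(1) e1 by (simp add: nn_integral_cmult_indicator ennreal_mult[symmetric])
    also have "\<dots> \<le> ennreal (W * (2 * e1))"
    proof (rule ennreal_leI)
      have "T * (real N * L) * (2 * e1) \<le> W * (2 * e1)"
        using W(2) e1 by (intro mult_right_mono) simp_all
      then show "real N * (L * (2 * e1)) * T \<le> W * (2 * e1)"
        by (simp add: mult.assoc mult.left_commute mult.commute)
    qed
    also have "W * (2 * e1) = e / 2"
      using W(1) by (simp add: e1_def field_simps)
    also have "ennreal (e / 2) < ennreal e"
      using e by (intro ennreal_lessI) simp_all
    finally show ?thesis .
  qed
  ultimately show ?thesis by blast
qed

end

theorem theorem3p5:
  fixes m lam :: "real \<Rightarrow> 'a::euclidean_space \<Rightarrow> real"
    and am ap :: "'a \<Rightarrow> 'a \<Rightarrow> real"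
  assumes m_nonneg: "\<And>t x. t \<ge> 0 \<Longrightarrow> m t x \<ge> 0"
    and m_cont: "continuous_on ({0..} \<times> UNIV) (\<lambda>(t, x). m t x)"
    and m_bdd: "bounded ((\<lambda>(t, x). m t x) ` ({0..} \<times> UNIV))"
    and lam_nonneg: "\<And>t x. t \<ge> 0 \<Longrightarrow> lam t x \<ge> 0"
    and lam_cont: "continuous_on ({0..} \<times> UNIV) (\<lambda>(t, x). lam t x)"
    and lam_bdd: "bounded ((\<lambda>(t, x). lam t x) ` ({0..} \<times> UNIV))"
    and am_nonneg: "\<And>x y. am x y \<ge> 0"
    and am_cont: "continuous_on UNIV (\<lambda>(x, y). am x y)"
    and am_bdd: "bounded (range (\<lambda>(x, y). am x y))"
    and ap_nonneg: "\<And>x y. ap x y \<ge> 0"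
    and ap_cont: "continuous_on UNIV (\<lambda>(x, y). ap x y)"
    and ap_integral: "\<And>x. has_bochner_integral lborel (ap x) 1"
    and ap_dominated: "\<And>\<Lambda>. compact \<Lambda> \<Longrightarrow>
      \<exists>astar. integrable lebesgue astar \<and> (\<forall>y. astar y \<ge> 0) \<and> (\<forall>x\<in>\<Lambda>. \<forall>y. ap x y \<le> astar y)"
  shows
    "(\<forall>\<epsilon>>0. \<forall>T>0. \<forall>B. compact B \<longrightarrow>
        (\<exists>A. compact A \<and>
          (\<forall>\<eta>\<in>B. (\<integral>\<^sup>+r\<in>{0..T}. bdlp_Q m am lam ap r \<eta> (- A) \<partial>lborel) < ennreal \<epsilon>))) \<and>
     (\<exists>c :: real \<Rightarrow> real. continuous_on {0..} c \<and> (\<forall>t\<ge>0. c t \<ge> 0) \<and>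
        (\<forall>t\<ge>0. \<forall>\<eta>. (\<integral>\<^sup>+\<omega>. ennreal (bdlp_V \<omega>) \<partial>bdlp_kernel m am lam ap t \<eta>) \<le>
          ennreal (c t * bdlp_V \<eta>) + bdlp_q m am lam ap t \<eta> * ennreal (bdlp_V \<eta>))) \<and>
     (\<forall>F :: 'a fset \<Rightarrow> real. continuous_on UNIV F \<longrightarrow>
        bdd_above (range (\<lambda>\<eta>. \<bar>F \<eta>\<bar> / (1 + bdlp_V \<eta>))) \<longrightarrow>
        (\<forall>t\<ge>0. \<forall>\<eta>. integrable (bdlp_kernel m am lam ap t \<eta>) F) \<and>
        continuous_on ({0..} \<times> UNIV) (\<lambda>(t, \<eta>). \<integral>\<omega>. F \<omega> \<partial>bdlp_kernel m am lam ap t \<eta>)) \<and>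
     (\<forall>T>0. \<exists>a>0. \<forall>\<eta>. \<forall>t\<in>{0..T}.
        bdlp_q m am lam ap t \<eta> \<le> ennreal (a * bdlp_V \<eta>))"
proof -
  interpret bdlp m lam am ap
    by unfold_locales fact+
  show ?thesis
  proof (intro conjI allI impI)
    show "\<exists>A. compact A \<and>
        (\<forall>\<eta>\<in>B. (\<integral>\<^sup>+r\<in>{0..T}. bdlp_Q m am lam ap r \<eta> (- A) \<partial>lborel) < ennreal \<epsilon>)"
      if "\<epsilon> > 0" "T > 0" "compact B" for \<epsilon> T and B :: "'a fset set"
      using that by (rule compact_containment)
    obtain c where "c \<ge> 0" "\<forall>t\<ge>0. \<forall>\<eta>. (\<integral>\<^sup>+\<omega>. ennreal (bdlp_V \<omega>) \<partial>bdlp_kernel m am lam ap t \<eta>) \<le>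
        ennreal (c * bdlp_V \<eta>) + bdlp_q m am lam ap t \<eta> * ennreal (bdlp_V \<eta>)"
      using drift_inequality by blast
    then show "\<exists>c :: real \<Rightarrow> real. continuous_on {0..} c \<and> (\<forall>t\<ge>0. c t \<ge> 0) \<and>
        (\<forall>t\<ge>0. \<forall>\<eta>. (\<integral>\<^sup>+\<omega>. ennreal (bdlp_V \<omega>) \<partial>bdlp_kernel m am lam ap t \<eta>) \<le>
          ennreal (c t * bdlp_V \<eta>) + bdlp_q m am lam ap t \<eta> * ennreal (bdlp_V \<eta>))"
      by (intro exI[of _ "\<lambda>_. c"]) simp
    show "integrable (bdlp_kernel m am lam ap t \<eta>) F"
      if "continuous_on UNIV F" "bdd_above (range (\<lambda>\<eta>. \<bar>F \<eta>\<bar> / (1 + bdlp_V \<eta>)))" "t \<ge> 0"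
      for F :: "'a fset \<Rightarrow> real" and t \<eta>
      using that by (rule continuous_integral_bdlp_kernel(1))
    show "continuous_on ({0..} \<times> UNIV) (\<lambda>(t, \<eta>). \<integral>\<omega>. F \<omega> \<partial>bdlp_kernel m am lam ap t \<eta>)"
      if "continuous_on UNIV F" "bdd_above (range (\<lambda>\<eta>. \<bar>F \<eta>\<bar> / (1 + bdlp_V \<eta>)))"
      for F :: "'a fset \<Rightarrow> real"
      using that by (rule continuous_integral_bdlp_kernel(2))
    obtain a where "a > 0" "\<forall>\<eta>. \<forall>t\<ge>0. bdlp_q m am lam ap t \<eta> \<le> ennreal (a * bdlp_V \<eta>)"
      using exit_rate_le by blast
    then show "\<exists>a>0. \<forall>\<eta>. \<forall>t\<in>{0..T}. bdlp_q m am lam ap t \<eta> \<le> ennreal (a * bdlp_V \<eta>)" for T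
      by (intro exI[of _ a]) auto
  qed
qed

end
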